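(* Let $p_1,q_1,\ldots,p_r,q_r$ be nonnegative integers, and for $1\le i\le r$ let $h_i=(p_i,1^{q_i})$ be a hook, where the expression $\mathrm{rib}(h_1,\ldots,h_r)$ of the resulting ribbon uses the minimum possible $r$. For $1\le i\le r$ let $\boldsymbol{\alpha}_i=(\alpha^{(i)}_1,\ldots,\alpha^{(i)}_{p_i})$ be positive integers with $\alpha^{(i)}_{p_i}\ge2$ (if $p_i\ge1$), and $\boldsymbol{\beta}_i=(\beta^{(i)}_1,\ldots,\beta^{(i)}_{q_i})$ positive integers, where for $i=r$ also $\beta^{(r)}_{q_r}\ge2$ (if $q_r\ge1$). Let $\boldsymbol{\gamma}_i$ be the filling of $h_i$ with first row $\alpha^{(i)}_1,\ldots,\alpha^{(i)}_{p_i}$ and below the first box of that row the entries $\beta^{(i)}_1,\ldots,\beta^{(i)}_{q_i}$ from top to bottom, and let $\boldsymbol{\gamma}=\boldsymbol{\gamma}_1\sqcup\cdots\sqcup\boldsymbol{\gamma}_r\in I_{\mathrm{rib}(h_1,\ldots,h_r)}$ be obtained by connecting $\boldsymbol{\gamma}_1,\ldots,\boldsymbol{\gamma}_r$ from the top right to the bottom left. Put $A^{(i)}_k=\alpha^{(i)}_{p_i}+\alpha^{(i)}_{p_i-1}+\cdots+\alpha^{(i)}_{p_i+1-k}$ for $0\le k\le p_i$, $B^{(i)}_l=\beta^{(i)}_1+\cdots+\beta^{(i)}_l$ for $0\le l\le q_i$ (so $A^{(i)}_0=B^{(i)}_0=0$), $|\boldsymbol{\alpha}_i|=A^{(i)}_{p_i}$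 and $|\boldsymbol{\beta}_i|=B^{(i)}_{q_i}$. Then $$\zeta_{\mathrm{rib}(h_1,\ldots,h_r)}(\boldsymbol{\gamma})=\int_{\Delta(\boldsymbol{\gamma})}\prod_{i=1}^r\left[\prod_{k=1}^{p_i}\left(\frac{dx^{(i)}_{A^{(i)}_{k-1}+1}}{1-x^{(i)}_{A^{(i)}_{k-1}+1}}\prod_{j=A^{(i)}_{k-1}+2}^{A^{(i)}_k}\frac{dx^{(i)}_j}{x^{(i)}_j}\right)\times\prod_{l=1}^{q_i}\left(\frac{dy^{(i)}_{B^{(i)}_{l-1}+1}}{1-y^{(i)}_{B^{(i)}_{l-1}+1}}\prod_{j=B^{(i)}_{l-1}+2}^{B^{(i)}_l}\frac{dy^{(i)}_j}{y^{(i)}_j}\right)\right],$$ where $\Delta(\boldsymbol{\gamma})$ is the set of $(\boldsymbol{x}_1,\boldsymbol{y}_1,\ldots,\boldsymbol{x}_r,\boldsymbol{y}_r)\in[0,1]^{\sum_{i=1}^r(|\boldsymbol{\alpha}_i|+|\boldsymbol{\beta}_i|)}$, $\boldsymbol{x}_i=(x^{(i)}_1,\ldots,x^{(i)}_{|\boldsymbol{\alpha}_i|})$, $\boldsymbol{y}_i=(y^{(i)}_1,\ldots,y^{(i)}_{|\boldsymbol{\beta}_i|})$, satisfying: (a) for $1\le i\le r$ and $1\le j<|\boldsymbol{\alpha}_i|$: $x^{(i)}_j<x^{(i)}_{j+1}$ if $j\notin\{A^{(i)}_1,\ldots,A^{(i)}_{p_i-1}\}$, and $x^{(i)}_j>x^{(i)}_{j+1}$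 if $j\in\{A^{(i)}_1,\ldots,A^{(i)}_{p_i-1}\}$; (b) for $1\le i\le r$: $y^{(i)}_1<y^{(i)}_2<\cdots<y^{(i)}_{|\boldsymbol{\beta}_i|}$; (c) for $1\le i\le r$ with $p_i\ne0$: $x^{(i)}_{|\boldsymbol{\alpha}_i|}<y^{(i)}_1$ if $q_i\ne0$, and $x^{(i)}_{|\boldsymbol{\alpha}_i|}<x^{(i+1)}_1$ if $q_i=0$ and $i<r$; (d) for $1\le i\le r-1$ with $q_i\ne0$: $y^{(i)}_{|\boldsymbol{\beta}_i|}<x^{(i+1)}_1$.
   Context: Hooks and ribbons: $(p,1^q)$ is the hook with a first row of $p$ boxes and $q$ further boxes below the first box of this row; for $p=0$ it is the column $(1^q)$, for $q=0$ the row $(p)$. $\mathrm{rib}(h_1,\ldots,h_r)=\mathrm{rib}(p_1,q_1|\cdots|p_r,q_r)$ is the ribbon (connected skew diagram with no $2\times2$ block) obtained by connecting the hooks $h_1,\ldots,h_r$ from the top right to the bottom left, i.e. the top-right box of $h_{i+1}$ is placed directly below the bottom-left box of $h_i$. For example, $\mathrm{rib}(4,1|2,3)$ is the skew diagram with rows occupying columns $\{2,3,4,5\},\{2\},\{1,2\},\{1\},\{1\},\{1\}$. To make expressions of a ribbon unambiguous, the minimum possible $r$ is always chosen (so $p_i\neq 0$ for $i\ge2$). For a skew diagram $\nu$ with box set $D(\nu)$ and corners $C(\nu)=\{(i,j)\in D(\nu):(i+1,j),(i,j+1)\notin D(\nu)\}$, $I_\nu$ is the set of fillings $(\gamma_{ij})$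 of $D(\nu)$ by positive integers with $\gamma_{ij}\ge2$ for all $(i,j)\in C(\nu)$. For $\boldsymbol{\gamma}\in I_\nu$, $$\zeta_\nu(\boldsymbol{\gamma})=\sum_{(m_{ij})}\prod_{(i,j)\in D(\nu)}m_{ij}^{-\gamma_{ij}},$$ the sum running over semi-standard fillings $(m_{ij})$ of $D(\nu)$ by positive integers (rows weakly increasing left to right, columns strictly increasing top to bottom). Empty sums are $0$, empty products are $1$, and conditions involving variables of an empty block are vacuous. *)

theory Defs
  imports "HOL-Analysis.Analysis"
begin

text \<open>A box is a pair (row, column), counted from 1; rows go downwards. A diagram is its set of
  boxes. A filling is a function on boxes of which only the values on the diagram matter.\<close>

type_synonym box = "nat \<times> nat"

section \<open>Schur multiple zeta values\<close>

definition corners :: "box set \<Rightarrow> box set" where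
  "corners D = {(i, j). (i, j) \<in> D \<and> (i + 1, j) \<notin> D \<and> (i, j + 1) \<notin> D}"

text \<open>The set $I_\nu$ for $D = D(\nu)$.\<close>

definition admissible_fillings :: "box set \<Rightarrow> (box \<Rightarrow> nat) set" where
  "admissible_fillings D = {\<gamma>. (\<forall>b\<in>D. 1 \<le> \<gamma> b) \<and> (\<forall>b\<in>corners D. 2 \<le> \<gamma> b)}"

text \<open>Extensionality (\<open>\<rightarrow>\<^sub>E\<close>) makes each semi-standard filling of \<open>D\<close> occur exactly once.\<close>

definition semistandard_fillings :: "box set \<Rightarrow> (box \<Rightarrow> nat) set" where
  "semistandard_fillings D = {m \<in> D \<rightarrow>\<^sub>E {1..}.
     (\<forall>i j j'. (i, j) \<in> D \<and> (i, j') \<in> D \<and> j < j' \<longrightarrow> m (i, j) \<le> m (i, j')) \<and>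
     (\<forall>i i' j. (i, j) \<in> D \<and> (i', j) \<in> D \<and> i < i' \<longrightarrow> m (i, j) < m (i', j))}"

definition schur_zeta_term :: "box set \<Rightarrow> (box \<Rightarrow> nat) \<Rightarrow> (box \<Rightarrow> nat) \<Rightarrow> real" where
  "schur_zeta_term D \<gamma> m = (\<Prod>b\<in>D. 1 / real (m b) ^ \<gamma> b)"

definition schur_zeta :: "box set \<Rightarrow> (box \<Rightarrow> nat) \<Rightarrow> real" where
  "schur_zeta D \<gamma> = (\<Sum>\<^sub>\<infinity>m\<in>semistandard_fillings D. schur_zeta_term D \<gamma> m)"

section \<open>Hooks and ribbons\<close>

text \<open>The number of rows above the leg of the hook $(p, 1^q)$: for \<open>p = 0\<close> the hook is the
  column $(1^q)$.\<close>

definition arm_height :: "nat \<Rightarrow> nat" where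
  "arm_height p = (if p = 0 then 0 else 1)"

definition hook :: "nat \<Rightarrow> nat \<Rightarrow> box set" where
  "hook p q = {(1, j) |j. j \<in> {1..p}} \<union> {(arm_height p + l, 1) |l. l \<in> {1..q}}"

definition hook_filling :: "nat \<Rightarrow> (nat \<Rightarrow> nat) \<Rightarrow> (nat \<Rightarrow> nat) \<Rightarrow> box \<Rightarrow> nat" where
  "hook_filling p \<alpha> \<beta> = (\<lambda>(i, j). if i \<le> arm_height p then \<alpha> j else \<beta> (i - arm_height p))"

text \<open>The position in the ribbon of the box \<open>b\<close> of the \<open>i\<close>-th hook. The hook has
  \<open>arm_height (p i) + q i\<close> rows, and the next hook starts in the row below its last one. The
  rightmost column of the next hook is the leftmost column of the \<open>i\<close>-th, so that the \<open>i\<close>-th hook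
  is shifted to the right by the sum of (width - 1) over all later hooks; the truncated
  \<open>p j - 1\<close> is (width - 1) also for the column \<open>p j = 0\<close>. The first row and the first column of the
  ribbon have number 1.\<close>

definition rib_position :: "nat \<Rightarrow> (nat \<Rightarrow> nat) \<Rightarrow> (nat \<Rightarrow> nat) \<Rightarrow> nat \<Rightarrow> box \<Rightarrow> box" where
  "rib_position r p q i = (\<lambda>(a, b).
     (a + (\<Sum>j\<in>{1..<i}. arm_height (p j) + q j), b + (\<Sum>j\<in>{i<..r}. p j - 1)))"

definition rib :: "nat \<Rightarrow> (nat \<Rightarrow> nat) \<Rightarrow> (nat \<Rightarrow> nat) \<Rightarrow> box set" where
  "rib r p q = (\<Union>i\<in>{1..r}. rib_position r p q i ` hook (p i) (q i))"

lemma rib_example: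
  fixes p q :: "nat \<Rightarrow> nat"
  assumes "p 1 = 4" "q 1 = 1" "p 2 = 2" "q 2 = 3"
  shows "rib 2 p q =
    {(1, 2), (1, 3), (1, 4), (1, 5), (2, 2), (3, 1), (3, 2), (4, 1), (5, 1), (6, 1)}"
proof -
  have I: "{1..2} = {1, 2::nat}" "{1..3} = {1, 2, 3::nat}" "{1..4} = {1, 2, 3, 4::nat}"
    by auto
  have J: "{1<..2} = {2::nat}" "{2<..2} = ({} :: nat set)" "{1..<2} = {1::nat}"
    by auto
  have H: "hook 4 1 = {(1, 1), (1, 2), (1, 3), (1, 4), (2, 1)}"
    "hook 2 3 = {(1, 1), (1, 2), (2, 1), (3, 1), (4, 1)}"
    unfolding hook_def arm_height_def I by auto
  have P: "rib_position 2 p q 1 = (\<lambda>(a, b). (a, b + 1))"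
    "rib_position 2 p q 2 = (\<lambda>(a, b). (a + 2, b))"
    unfolding rib_position_def J using assms by (simp_all add: arm_height_def fun_eq_iff)
  have "rib 2 p q = rib_position 2 p q 1 ` hook 4 1 \<union> rib_position 2 p q 2 ` hook 2 3"
    unfolding rib_def I using assms by simp
  then show ?thesis
    unfolding P H by (simp add: insert_commute numeral_eq_Suc)
qed

text \<open>The number \<open>r\<close> of hooks is the minimum possible one among all expressions of the same
  ribbon.\<close>

definition minimal_expression :: "nat \<Rightarrow> (nat \<Rightarrow> nat) \<Rightarrow> (nat \<Rightarrow> nat) \<Rightarrow> bool" where
  "minimal_expression r p q \<longleftrightarrow>
     (\<forall>r' p' q'. 1 \<le> r' \<and> rib r' p' q' = rib r p q \<longrightarrow> r \<le> r')"

text \<open>\<open>\<gamma>\<close> is (on the ribbon) the filling obtained by connecting the fillings \<open>\<Gamma> 1, \<dots>, \<Gamma> r\<close> of the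
  hooks.\<close>

definition connects_fillings ::
  "nat \<Rightarrow> (nat \<Rightarrow> nat) \<Rightarrow> (nat \<Rightarrow> nat) \<Rightarrow> (nat \<Rightarrow> box \<Rightarrow> nat) \<Rightarrow> (box \<Rightarrow> nat) \<Rightarrow> bool" where
  "connects_fillings r p q \<Gamma> \<gamma> \<longleftrightarrow>
     (\<forall>i\<in>{1..r}. \<forall>b\<in>hook (p i) (q i). \<gamma> (rib_position r p q i b) = \<Gamma> i b)"

section \<open>The integral\<close>

text \<open>\<open>A_sum p \<alpha> i k\<close> and \<open>B_sum \<beta> i l\<close> are $A^{(i)}_k$ (for $k \leq p_i$) and $B^{(i)}_l$.\<close>

definition A_sum :: "(nat \<Rightarrow> nat) \<Rightarrow> (nat \<Rightarrow> nat \<Rightarrow> nat) \<Rightarrow> nat \<Rightarrow> nat \<Rightarrow> nat" where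
  "A_sum p \<alpha> i k = (\<Sum>t\<in>{p i + 1 - k..p i}. \<alpha> i t)"

definition B_sum :: "(nat \<Rightarrow> nat \<Rightarrow> nat) \<Rightarrow> nat \<Rightarrow> nat \<Rightarrow> nat" where
  "B_sum \<beta> i l = (\<Sum>t\<in>{1..l}. \<beta> i t)"

text \<open>The names of the integration variables $x^{(i)}_j$ and $y^{(i)}_j$; a point of
  $\mathbb{R}^N$ is a function on the finite set \<open>ivars\<close> of all variables.\<close>

datatype ivar = Xvar nat nat | Yvar nat nat

definition ivars :: "nat \<Rightarrow> (nat \<Rightarrow> nat) \<Rightarrow> (nat \<Rightarrow> nat) \<Rightarrow> (nat \<Rightarrow> nat \<Rightarrow> nat) \<Rightarrow>
    (nat \<Rightarrow> nat \<Rightarrow> nat) \<Rightarrow> ivar set" where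
  "ivars r p q \<alpha> \<beta> =
     {Xvar i j |i j. i \<in> {1..r} \<and> j \<in> {1..A_sum p \<alpha> i (p i)}} \<union>
     {Yvar i j |i j. i \<in> {1..r} \<and> j \<in> {1..B_sum \<beta> i (q i)}}"

abbreviation ivars_measure :: "nat \<Rightarrow> (nat \<Rightarrow> nat) \<Rightarrow> (nat \<Rightarrow> nat) \<Rightarrow> (nat \<Rightarrow> nat \<Rightarrow> nat) \<Rightarrow>
    (nat \<Rightarrow> nat \<Rightarrow> nat) \<Rightarrow> (ivar \<Rightarrow> real) measure" where
  "ivars_measure r p q \<alpha> \<beta> \<equiv> (\<Pi>\<^sub>M v\<in>ivars r p q \<alpha> \<beta>. lborel)"

text \<open>The guards \<open>p (i + 1) \<noteq> 0\<close> only express the convention that conditions on variables of an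
  empty block are vacuous; they always hold for a minimal expression.\<close>

definition \<Delta> :: "nat \<Rightarrow> (nat \<Rightarrow> nat) \<Rightarrow> (nat \<Rightarrow> nat) \<Rightarrow> (nat \<Rightarrow> nat \<Rightarrow> nat) \<Rightarrow>
    (nat \<Rightarrow> nat \<Rightarrow> nat) \<Rightarrow> (ivar \<Rightarrow> real) set" where
  "\<Delta> r p q \<alpha> \<beta> = {z \<in> ivars r p q \<alpha> \<beta> \<rightarrow>\<^sub>E {0..1}.
     (\<forall>i\<in>{1..r}. \<forall>j. 1 \<le> j \<and> j < A_sum p \<alpha> i (p i) \<longrightarrow>
        (if j \<in> A_sum p \<alpha> i ` {1..<p i} then z (Xvar i j) > z (Xvar i (j + 1))
         else z (Xvar i j) < z (Xvar i (j + 1)))) \<and>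
     (\<forall>i\<in>{1..r}. \<forall>j. 1 \<le> j \<and> j < B_sum \<beta> i (q i) \<longrightarrow> z (Yvar i j) < z (Yvar i (j + 1))) \<and>
     (\<forall>i\<in>{1..r}. p i \<noteq> 0 \<longrightarrow>
        (q i \<noteq> 0 \<longrightarrow> z (Xvar i (A_sum p \<alpha> i (p i))) < z (Yvar i 1)) \<and>
        (q i = 0 \<and> i < r \<and> p (i + 1) \<noteq> 0 \<longrightarrow> z (Xvar i (A_sum p \<alpha> i (p i))) < z (Xvar (i + 1) 1))) \<and>
     (\<forall>i\<in>{1..<r}. q i \<noteq> 0 \<and> p (i + 1) \<noteq> 0 \<longrightarrow>
        z (Yvar i (B_sum \<beta> i (q i))) < z (Xvar (i + 1) 1))}"

definition integrand :: "nat \<Rightarrow> (nat \<Rightarrow> nat) \<Rightarrow> (nat \<Rightarrow> nat) \<Rightarrow> (nat \<Rightarrow> nat \<Rightarrow> nat) \<Rightarrow>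
    (nat \<Rightarrow> nat \<Rightarrow> nat) \<Rightarrow> (ivar \<Rightarrow> real) \<Rightarrow> real" where
  "integrand r p q \<alpha> \<beta> z =
     (\<Prod>i\<in>{1..r}.
        (\<Prod>k\<in>{1..p i}. 1 / (1 - z (Xvar i (A_sum p \<alpha> i (k - 1) + 1))) *
           (\<Prod>j\<in>{A_sum p \<alpha> i (k - 1) + 2..A_sum p \<alpha> i k}. 1 / z (Xvar i j))) *
        (\<Prod>l\<in>{1..q i}. 1 / (1 - z (Yvar i (B_sum \<beta> i (l - 1) + 1))) *
           (\<Prod>j\<in>{B_sum \<beta> i (l - 1) + 2..B_sum \<beta> i l}. 1 / z (Yvar i j))))"

end

theory Submission
  imports Defs
begin

text \<open>
Both sides are evaluated by one pass along the ribbon, from the top right box to the bottom left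
one. Along this path consecutive boxes are neighbours, and the conditions of a semi-standard
filling reduce to one inequality per step: \<open>m \<ge> m'\<close> for a step to the left and \<open>m < m'\<close> for a step
down (\<open>semistandard_ribbon_path\<close>). The integration variables form a chain in the same way: a box of
exponent $e$ contributes a block of $e$ consecutive variables, the first with the form
$dt/(1-t)$ and the others with $dt/t$; variables increase along the chain, except that the step
into the block of a box reached by a step to the left is a decrease (\<open>\<Delta>_eq\<close>).

Integrating the variables out in this order, one keeps a function of the current variable, and
summing over the entries in this order, one keeps a function of the current entry. The two are
related by $D(t) = \sum_{m \ge 1} c_m m t^{m-1}$, where $c_m$ is the sum over the boxes so far
with current entry $m$. Indeed
$\frac{1}{1-t} \int_0^t D = \sum_m c_m \frac{t^m}{1-t} = \sum_k (\sum_{m<k} c_m) t^{k-1}$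
and
$\frac{1}{1-t} \int_t^1 D = \sum_m c_m \frac{1-t^m}{1-t} = \sum_k (\sum_{m \ge k} c_m) t^{k-1}$
are the steps down and to the left, and every further $dt/t$ divides the coefficient of $t^{k-1}$
by $k$; since this coefficient of $D$ is $k c_k$, a block of $e$ variables produces the factor
$k^{-e}$ (\<open>box_series_step\<close>). At
the end $\int_0^1 D = \sum_m c_m$. All terms are nonnegative, hence these interchanges need no convergence and
give an equality in $[0,\infty]$ for every chain (\<open>chain_integral_eq_chain_sum\<close>).

Finiteness is shown on the side of the sum: $c_m = O(m^{-1/2})$ is preserved by every step down, and
is improved to $O(m^{-3/2})$ at a box with exponent at least 2; this better bound is preserved by steps to the
left. The rightmost box of every row has exponent at least 2, and so has the last box of the ribbon if it
lies in a leg; hence the last $c$ is summable (\<open>chain_sum_finite\<close>).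

Minimality of the expression gives $p_i \ge 1$ for $i \ge 2$, since a hook without arm could be merged
with the previous hook (\<open>minimal_expression_arm_pos\<close>). Hence the step from each hook to the next
one ends in the row of the latter.
\<close>

section \<open>Integrals over chains of variables\<close>

text \<open>The weight of a chain is a product of kernels of consecutive variables. The kernel is indexed by
the later of the two variables; the weight of the first variable \<open>v\<close> is left out, so that it can
be an arbitrary function, which changes as variables are integrated out.\<close>

fun chain_weight :: "('v \<Rightarrow> 'a \<Rightarrow> 'a \<Rightarrow> ennreal) \<Rightarrow> 'v \<Rightarrow> 'v list \<Rightarrow> ('v \<Rightarrow> 'a) \<Rightarrow> ennreal" where
  "chain_weight \<kappa> v [] x = 1"
| "chain_weight \<kappa> v (w # l) x = \<kappa> w (x v) (x w) * chain_weight \<kappa> w l x"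

lemma chain_weight_cong:
  assumes "\<And>w. w \<in> set (v # l) \<Longrightarrow> x w = y w"
  shows "chain_weight \<kappa> v l x = chain_weight \<kappa> v l y"
  using assms by (induction l arbitrary: v) auto

lemma chain_weight_eq:
  assumes "\<And>w s t. w \<in> set l \<Longrightarrow> \<kappa> w s t = of_bool (R w s t) * f w t"
  shows "chain_weight \<kappa> v l x =
    of_bool (successively (\<lambda>u w. R w (x u) (x w)) (v # l)) * prod_list (map (\<lambda>w. f w (x w)) l)"
  using assms by (induction l arbitrary: v) (auto simp: mult_ac)

lemma measurable_chain_weight:
  assumes "\<And>w. w \<in> set l \<Longrightarrow> case_prod (\<kappa> w) \<in> borel_measurable (M \<Otimes>\<^sub>M M)"
    and "set (v # l) \<subseteq> I"
  shows "chain_weight \<kappa> v l \<in> borel_measurable (Pi\<^sub>M I (\<lambda>_. M))"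
  using assms
proof (induction l arbitrary: v)
  case (Cons w l)
  have [measurable]: "case_prod (\<kappa> w) \<in> borel_measurable (M \<Otimes>\<^sub>M M)"
    and [measurable]: "chain_weight \<kappa> w l \<in> borel_measurable (Pi\<^sub>M I (\<lambda>_. M))"
    and [measurable]: "v \<in> I" "w \<in> I"
    using Cons by auto
  have "(\<lambda>x. \<kappa> w (x v) (x w)) \<in> borel_measurable (Pi\<^sub>M I (\<lambda>_. M))"
    by measurable
  then show ?case
    by simp
next
  case (Nil v)
  have "chain_weight \<kappa> v [] = (\<lambda>x. 1)"
    by (rule ext) simp
  then show ?case
    by simp
qed

definition push :: "'a measure \<Rightarrow> ('a \<Rightarrow> 'a \<Rightarrow> ennreal) \<Rightarrow> ('a \<Rightarrow> ennreal) \<Rightarrow> 'a \<Rightarrow> ennreal" where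
  "push M K D = (\<lambda>y. \<integral>\<^sup>+x. D x * K x y \<partial>M)"

lemma measurable_push:
  assumes "sigma_finite_measure M" and [measurable]: "D \<in> borel_measurable M"
    "case_prod K \<in> borel_measurable (M \<Otimes>\<^sub>M M)"
  shows "push M K D \<in> borel_measurable M"
proof -
  interpret sigma_finite_measure M by fact
  show ?thesis
    unfolding push_def by (rule borel_measurable_nn_integral) measurable
qed

text \<open>The first variable occurs only in its own weight and in the first kernel. Integrating it out leaves
a shorter chain, with a new weight for its first variable.\<close>

lemma nn_integral_chain:
  assumes M: "sigma_finite_measure M" and D: "D \<in> borel_measurable M"
    and K: "\<And>w. w \<in> set l \<Longrightarrow> case_prod (\<kappa> w) \<in> borel_measurable (M \<Otimes>\<^sub>M M)"
    and dist: "distinct (v # l)"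
  shows "(\<integral>\<^sup>+x. D (x v) * chain_weight \<kappa> v l x \<partial>Pi\<^sub>M (set (v # l)) (\<lambda>_. M)) =
    (\<integral>\<^sup>+y. fold (\<lambda>w. push M (\<kappa> w)) l D y \<partial>M)"
  using D K dist
proof (induction l arbitrary: v D)
  case Nil
  interpret product_sigma_finite "\<lambda>_. M"
    using M by (simp add: product_sigma_finite_def)
  show ?case
    using Nil by (simp add: product_nn_integral_singleton)
next
  case (Cons w l)
  interpret product_sigma_finite "\<lambda>_. M"
    using M by (simp add: product_sigma_finite_def)
  have [measurable]: "D \<in> borel_measurable M" and Kw[measurable]: "case_prod (\<kappa> w) \<in> borel_measurable (M \<Otimes>\<^sub>M M)"
    and Kl: "\<And>u. u \<in> set l \<Longrightarrow> case_prod (\<kappa> u) \<in> borel_measurable (M \<Otimes>\<^sub>M M)"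
    using Cons.prems by auto
  let ?I = "set (w # l)"
  have v: "v \<notin> ?I" and set_eq: "set (v # w # l) = insert v ?I"
    using Cons.prems by auto
  have [measurable]: "chain_weight \<kappa> v (w # l) \<in> borel_measurable (Pi\<^sub>M (insert v ?I) (\<lambda>_. M))"
    using Cons.prems by (intro measurable_chain_weight) auto
  have "(\<integral>\<^sup>+x. D (x v) * chain_weight \<kappa> v (w # l) x \<partial>Pi\<^sub>M (insert v ?I) (\<lambda>_. M)) =
    (\<integral>\<^sup>+x. (\<integral>\<^sup>+y. D ((x(v := y)) v) * chain_weight \<kappa> v (w # l) (x(v := y)) \<partial>M) \<partial>Pi\<^sub>M ?I (\<lambda>_. M))"
  proof (rule product_nn_integral_insert)
    have [measurable]: "v \<in> insert v ?I"
      by simp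
    show "(\<lambda>x. D (x v) * chain_weight \<kappa> v (w # l) x) \<in> borel_measurable (Pi\<^sub>M (insert v ?I) (\<lambda>_. M))"
      by measurable
  qed (use v in auto)
  also have "\<dots> = (\<integral>\<^sup>+x. push M (\<kappa> w) D (x w) * chain_weight \<kappa> w l x \<partial>Pi\<^sub>M ?I (\<lambda>_. M))"
  proof (rule nn_integral_cong)
    fix x assume x: "x \<in> space (Pi\<^sub>M ?I (\<lambda>_. M))"
    then have xw [measurable]: "x w \<in> space M"
      by (auto simp: space_PiM)
    have "chain_weight \<kappa> w l (x(v := y)) = chain_weight \<kappa> w l x" for y
      using v by (intro chain_weight_cong) auto
    moreover have "(x(v := y)) w = x w" for y
      using v by auto
    ultimately have "(\<integral>\<^sup>+y. D ((x(v := y)) v) * chain_weight \<kappa> v (w # l) (x(v := y)) \<partial>M) =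
      (\<integral>\<^sup>+y. (D y * \<kappa> w y (x w)) * chain_weight \<kappa> w l x \<partial>M)"
      by (simp add: mult.assoc)
    also have "\<dots> = push M (\<kappa> w) D (x w) * chain_weight \<kappa> w l x"
      unfolding push_def
    proof (rule nn_integral_multc)
      have "(\<lambda>y. case_prod (\<kappa> w) (y, x w)) \<in> borel_measurable M"
        using xw by measurable
      then show "(\<lambda>y. D y * \<kappa> w y (x w)) \<in> borel_measurable M"
        by simp
    qed
    finally show "(\<integral>\<^sup>+y. D ((x(v := y)) v) * chain_weight \<kappa> v (w # l) (x(v := y)) \<partial>M) =
      push M (\<kappa> w) D (x w) * chain_weight \<kappa> w l x" .
  qed
  also have "\<dots> = (\<integral>\<^sup>+y. fold (\<lambda>w. push M (\<kappa> w)) l (push M (\<kappa> w) D) y \<partial>M)"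
    using Cons.prems Kl by (intro Cons.IH measurable_push M) auto
  finally show ?case
    unfolding set_eq by simp
qed

section \<open>Power series under one integration\<close>

abbreviation pos_count :: "nat measure" where
  "pos_count \<equiv> count_space {1..}"

lemma nn_integral_pos_count: "(\<integral>\<^sup>+m. f m \<partial>pos_count) = (\<Sum>n. f (Suc n))"
proof -
  have "bij_betw Suc UNIV {1..}"
    by (auto simp: bij_betw_def image_iff Suc_le_eq gr0_conv_Suc)
  then have "(\<integral>\<^sup>+m. f m \<partial>pos_count) = (\<integral>\<^sup>+n. f (Suc n) \<partial>count_space UNIV)"
    by (rule nn_integral_bij_count_space[symmetric])
  then show ?thesis
    by (simp add: nn_integral_count_space_nat)
qed

lemma nn_integral_pos_count_swap:
  fixes f :: "nat \<Rightarrow> nat \<Rightarrow> ennreal"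
  shows "(\<integral>\<^sup>+k. \<integral>\<^sup>+m. f m k \<partial>pos_count \<partial>pos_count) = (\<integral>\<^sup>+m. \<integral>\<^sup>+k. f m k \<partial>pos_count \<partial>pos_count)"
  by (rule nn_integral_count_space_nn_integral) auto

text \<open>The two expansions of $t^m/(1-t)$ and $(1-t^m)/(1-t)$ in which the inequalities between
neighbouring entries of a filling originate.\<close>

lemma geometric_tail:
  assumes "0 < t" "t < 1"
  shows "(\<integral>\<^sup>+k. of_bool (m < k) * ennreal (t ^ (k - 1)) \<partial>pos_count) = ennreal (t ^ m / (1 - t))"
proof -
  have "(\<integral>\<^sup>+k. of_bool (m < k) * ennreal (t ^ (k - 1)) \<partial>pos_count) =
    (\<Sum>n. of_bool (m \<le> n) * ennreal (t ^ n))"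
    by (subst nn_integral_pos_count) (simp add: less_Suc_eq_le)
  also have "\<dots> = (\<Sum>n. ennreal (of_bool (m \<le> n) * t ^ n))"
    by (intro suminf_cong) auto
  also have "\<dots> = ennreal (t ^ m / (1 - t))"
  proof (rule suminf_ennreal_eq)
    have "(\<lambda>n. t ^ n) sums (1 / (1 - t))"
      using assms by (intro geometric_sums) auto
    then have "(\<lambda>n. t ^ m * t ^ n) sums (t ^ m * (1 / (1 - t)))"
      by (rule sums_mult)
    then have "(\<lambda>n. of_bool (m \<le> n + m) * t ^ (n + m)) sums (t ^ m / (1 - t))"
      by (simp add: power_add mult_ac)
    then show "(\<lambda>n. of_bool (m \<le> n) * t ^ n) sums (t ^ m / (1 - t))"
      by (rule sums_zero_iff_shift[THEN iffD1, rotated]) auto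
  qed (use assms in auto)
  finally show ?thesis .
qed

lemma geometric_initial:
  assumes "0 < t" "t < 1"
  shows "(\<integral>\<^sup>+k. of_bool (k \<le> m) * ennreal (t ^ (k - 1)) \<partial>pos_count) = ennreal ((1 - t ^ m) / (1 - t))"
proof -
  have "(\<integral>\<^sup>+k. of_bool (k \<le> m) * ennreal (t ^ (k - 1)) \<partial>pos_count) =
    (\<Sum>n. of_bool (n < m) * ennreal (t ^ n))"
    by (subst nn_integral_pos_count) (simp add: Suc_le_eq)
  also have "\<dots> = (\<Sum>n<m. of_bool (n < m) * ennreal (t ^ n))"
    by (rule suminf_finite) auto
  also have "\<dots> = (\<Sum>n<m. ennreal (t ^ n))"
    by (intro sum.cong) auto
  also have "\<dots> = ennreal (\<Sum>n<m. t ^ n)"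
    using assms by (intro sum_ennreal) auto
  also have "(\<Sum>n<m. t ^ n) = (1 - t ^ m) / (1 - t)"
    using assms by (subst sum_gp_strict) auto
  finally show ?thesis .
qed

text \<open>The exponent is \<open>m - 1\<close> since \<open>c m\<close> belongs to the entry \<open>m \<ge> 1\<close> of a box. The identity is required
only almost everywhere because the forms are singular, and the kernels have default values, at 0 and 1.\<close>

definition density_series :: "(real \<Rightarrow> ennreal) \<Rightarrow> (nat \<Rightarrow> ennreal) \<Rightarrow> bool" where
  "density_series D c \<longleftrightarrow> D \<in> borel_measurable borel \<and> (AE t in lborel. D t =
     indicator {0<..<1} t * (\<integral>\<^sup>+m. c m * ennreal (t ^ (m - 1)) \<partial>pos_count))"

lemma density_seriesI:
  assumes "D \<in> borel_measurable borel"
    and "\<And>t. 0 < t \<Longrightarrow> t < 1 \<Longrightarrow> D t = (\<integral>\<^sup>+m. c m * ennreal (t ^ (m - 1)) \<partial>pos_count)"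
    and "\<And>t. t < 0 \<or> 1 < t \<Longrightarrow> D t = 0"
  shows "density_series D c"
proof -
  have "AE t in lborel. t \<noteq> (0::real)" "AE t in lborel. t \<noteq> (1::real)"
    by (rule AE_lborel_singleton)+
  then have "AE t in lborel. D t =
     indicator {0<..<1} t * (\<integral>\<^sup>+m. c m * ennreal (t ^ (m - 1)) \<partial>pos_count)"
  proof eventually_elim
    case (elim t)
    then consider "0 < t \<and> t < 1" | "t < 0 \<or> 1 < t"
      by linarith
    then show ?case
      using assms by cases auto
  qed
  then show ?thesis
    using assms(1) by (simp add: density_series_def)
qed

lemma nn_integral_power_interval:
  assumes "0 \<le> a" "a \<le> b" "1 \<le> m"
  shows "(\<integral>\<^sup>+x. ennreal (x ^ (m - 1)) * indicator {a<..<b} x \<partial>lborel) =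
    ennreal ((b ^ m - a ^ m) / real m)"
proof -
  have ab: "AE x in lborel. x \<noteq> a" "AE x in lborel. x \<noteq> b"
    by (rule AE_lborel_singleton)+
  have "(\<integral>\<^sup>+x. ennreal (x ^ (m - 1)) * indicator {a<..<b} x \<partial>lborel) =
    (\<integral>\<^sup>+x. ennreal (x ^ (m - 1)) * indicator {a..b} x \<partial>lborel)"
  proof (rule nn_integral_cong_AE)
    show "AE x in lborel. ennreal (x ^ (m - 1)) * indicator {a<..<b} x =
      ennreal (x ^ (m - 1)) * indicator {a..b} x"
      using ab by eventually_elim (auto simp: indicator_def)
  qed
  also have "\<dots> = ennreal (b ^ m / real m - a ^ m / real m)"
  proof (rule nn_integral_FTC_Icc)
    show "DERIV (\<lambda>x. x ^ m / real m) x :> x ^ (m - 1)" if "x \<in> {a..b}" for x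
      using assms by (auto intro!: derivative_eq_intros)
  qed (use assms in auto)
  finally show ?thesis
    by (simp add: diff_divide_distrib)
qed

lemma density_series_integral:
  assumes "density_series D c" "0 \<le> a" "a \<le> b" "b \<le> 1"
  shows "(\<integral>\<^sup>+x. D x * indicator {a<..<b} x \<partial>lborel) =
    (\<integral>\<^sup>+m. c m * ennreal ((b ^ m - a ^ m) / real m) \<partial>pos_count)"
proof -
  have "(\<integral>\<^sup>+x. D x * indicator {a<..<b} x \<partial>lborel) =
    (\<integral>\<^sup>+x. (\<integral>\<^sup>+m. c m * (ennreal (x ^ (m - 1)) * indicator {a<..<b} x) \<partial>pos_count) \<partial>lborel)"
  proof (rule nn_integral_cong_AE)
    show "AE x in lborel. D x * indicator {a<..<b} x =
      (\<integral>\<^sup>+m. c m * (ennreal (x ^ (m - 1)) * indicator {a<..<b} x) \<partial>pos_count)"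
      using assms(1)[unfolded density_series_def, THEN conjunct2]
      by eventually_elim (use assms in \<open>auto simp: indicator_def\<close>)
  qed
  also have "\<dots> = (\<integral>\<^sup>+m. (\<integral>\<^sup>+x. c m * (ennreal (x ^ (m - 1)) * indicator {a<..<b} x) \<partial>lborel) \<partial>pos_count)"
    by (rule nn_integral_count_space_nn_integral) auto
  also have "\<dots> = (\<integral>\<^sup>+m. c m * ennreal ((b ^ m - a ^ m) / real m) \<partial>pos_count)"
  proof (rule nn_integral_cong)
    fix m assume "m \<in> space pos_count"
    then have "1 \<le> m"
      by simp
    then show "(\<integral>\<^sup>+x. c m * (ennreal (x ^ (m - 1)) * indicator {a<..<b} x) \<partial>lborel) =
      c m * ennreal ((b ^ m - a ^ m) / real m)"
      using assms by (subst nn_integral_cmult) (auto simp: nn_integral_power_interval simp del: One_nat_def)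
  qed
  finally show ?thesis .
qed

text \<open>A form of the previous lemma for half-lines: \<open>D\<close> vanishes almost everywhere outside the unit
interval.\<close>

lemma density_series_integral_01:
  assumes "density_series D c" "0 \<le> a" "a \<le> b" "b \<le> 1"
    and S: "\<And>x. x \<in> {0<..<1} \<Longrightarrow> x \<in> S \<longleftrightarrow> x \<in> {a<..<b}"
  shows "(\<integral>\<^sup>+x. D x * indicator S x \<partial>lborel) =
    (\<integral>\<^sup>+m. c m * ennreal ((b ^ m - a ^ m) / real m) \<partial>pos_count)"
proof -
  have "(\<integral>\<^sup>+x. D x * indicator S x \<partial>lborel) = (\<integral>\<^sup>+x. D x * indicator {a<..<b} x \<partial>lborel)"
  proof (rule nn_integral_cong_AE)
    show "AE x in lborel. D x * indicator S x = D x * indicator {a<..<b} x"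
      using assms(1)[unfolded density_series_def, THEN conjunct2]
      by eventually_elim (use S in \<open>auto simp: indicator_def\<close>)
  qed
  then show ?thesis
    using density_series_integral[OF assms(1-4)] by simp
qed

text \<open>The forms $dt/t$ and $dt/(1-t)$. The indicator puts the condition that all variables lie in $[0,1]$
into the weight, so that the integrals can be taken over the whole line.\<close>

definition form0 :: "real \<Rightarrow> ennreal" where
  "form0 t = ennreal (indicator {0..1} t * (1 / t))"
definition form1 :: "real \<Rightarrow> ennreal" where
  "form1 t = ennreal (indicator {0..1} t * (1 / (1 - t)))"

lemma measurable_form [measurable]: "form0 \<in> borel_measurable borel" "form1 \<in> borel_measurable borel"
  unfolding form0_def form1_def by measurable

lemma density_series_form1: "density_series form1 (\<lambda>_. 1)"
proof (rule density_seriesI)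
  fix t :: real assume "0 < t" "t < 1"
  then have "form1 t = (\<integral>\<^sup>+k. of_bool (0 < k) * ennreal (t ^ (k - 1)) \<partial>pos_count)"
    by (subst geometric_tail) (auto simp: form1_def)
  also have "\<dots> = (\<integral>\<^sup>+m. 1 * ennreal (t ^ (m - 1)) \<partial>pos_count)"
    by (intro nn_integral_cong) auto
  finally show "form1 t = (\<integral>\<^sup>+m. 1 * ennreal (t ^ (m - 1)) \<partial>pos_count)" .
qed (auto simp: form1_def)

definition step_kernel :: "bool \<Rightarrow> (real \<Rightarrow> ennreal) \<Rightarrow> real \<Rightarrow> real \<Rightarrow> ennreal" where
  "step_kernel up f s t = of_bool (if up then t < s else s < t) * f t"

lemma measurable_step_kernel [measurable]:
  "f \<in> borel_measurable borel \<Longrightarrow> case_prod (step_kernel up f) \<in> borel_measurable (borel \<Otimes>\<^sub>M borel)"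
  unfolding step_kernel_def by (cases up) (simp_all, measurable)

lemma push_step_kernel:
  assumes "density_series D c" "0 < t" "t < 1"
  shows "push lborel (step_kernel up f) D t =
    (\<integral>\<^sup>+m. c m * ennreal ((if up then 1 - t ^ m else t ^ m) / real m) \<partial>pos_count) * f t"
proof -
  have [measurable]: "D \<in> borel_measurable borel"
    using assms by (simp add: density_series_def)
  define S where "S = (if up then {t<..} else {..<t})"
  define a where "a = (if up then t else 0)"
  define b where "b = (if up then 1 else t)"
  have S: "S \<in> sets borel" "x \<in> {0<..<1} \<Longrightarrow> x \<in> S \<longleftrightarrow> x \<in> {a<..<b}" for x
    using assms by (auto simp: S_def a_def b_def)
  have "push lborel (step_kernel up f) D t = (\<integral>\<^sup>+s. (D s * indicator S s) * f t \<partial>lborel)"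
    unfolding push_def step_kernel_def
    by (intro nn_integral_cong) (auto simp: S_def indicator_def mult.assoc)
  also have "\<dots> = (\<integral>\<^sup>+s. D s * indicator S s \<partial>lborel) * f t"
    using S(1) by (intro nn_integral_multc) simp
  also have "(\<integral>\<^sup>+s. D s * indicator S s \<partial>lborel) =
    (\<integral>\<^sup>+m. c m * ennreal ((b ^ m - a ^ m) / real m) \<partial>pos_count)"
    by (rule density_series_integral_01[OF assms(1)])
       (use assms S(2) in \<open>auto simp: a_def b_def\<close>)
  also have "\<dots> = (\<integral>\<^sup>+m. c m * ennreal ((if up then 1 - t ^ m else t ^ m) / real m) \<partial>pos_count)"
    by (rule nn_integral_cong) (auto simp: a_def b_def power_0_left)
  finally show ?thesis .
qed

text \<open>$\frac1t \int_0^t x^{m-1}dx = \frac1m t^{m-1}$, term by term.\<close>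

lemma density_series_push_form0:
  assumes "density_series D c"
  shows "density_series (push lborel (step_kernel False form0) D) (\<lambda>m. c m * ennreal (1 / real m))"
proof (rule density_seriesI)
  have [measurable]: "D \<in> borel_measurable borel"
    using assms by (simp add: density_series_def)
  have "push lborel (step_kernel False form0) D \<in> borel_measurable lborel"
    by (rule measurable_push) (auto intro: lborel.sigma_finite_measure_axioms)
  then show "push lborel (step_kernel False form0) D \<in> borel_measurable borel"
    by simp
  fix t :: real assume t: "0 < t" "t < 1"
  have "push lborel (step_kernel False form0) D t =
    (\<integral>\<^sup>+m. c m * ennreal (t ^ m / real m) * ennreal (1 / t) \<partial>pos_count)"
    using t by (subst push_step_kernel[OF assms]) (auto simp: form0_def nn_integral_multc)
  also have "\<dots> = (\<integral>\<^sup>+m. c m * ennreal (1 / real m) * ennreal (t ^ (m - 1)) \<partial>pos_count)"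
  proof (rule nn_integral_cong)
    fix m assume "m \<in> space pos_count"
    then obtain n where m: "m = Suc n"
      by (cases m) auto
    have "ennreal (t ^ m / real m) * ennreal (1 / t) = ennreal (1 / real m) * ennreal (t ^ (m - 1))"
      using t by (subst (1 2) ennreal_mult[symmetric]) (auto simp: m)
    then show "c m * ennreal (t ^ m / real m) * ennreal (1 / t) =
      c m * ennreal (1 / real m) * ennreal (t ^ (m - 1))"
      by (simp add: mult.assoc)
  qed
  finally show "push lborel (step_kernel False form0) D t = \<dots>" .
qed (auto simp: push_def step_kernel_def form0_def)

text \<open>The integral of $x^{m-1}$ over $(0,t)$ or $(t,1)$, divided by $1-t$, is $1/m$ times one of
the two geometric expansions; exchanging the order of summation collects the coefficient of
$t^{k-1}$.\<close>

lemma density_series_push_form1: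
  assumes "density_series D c"
  shows "density_series (push lborel (step_kernel up form1) D)
    (\<lambda>k. \<integral>\<^sup>+m. c m * ennreal (1 / real m) * of_bool (if up then k \<le> m else m < k) \<partial>pos_count)"
proof (rule density_seriesI)
  have [measurable]: "D \<in> borel_measurable borel"
    using assms by (simp add: density_series_def)
  have "push lborel (step_kernel up form1) D \<in> borel_measurable lborel"
    by (rule measurable_push) (auto intro: lborel.sigma_finite_measure_axioms)
  then show "push lborel (step_kernel up form1) D \<in> borel_measurable borel"
    by simp
  fix t :: real assume t: "0 < t" "t < 1"
  let ?R = "\<lambda>m k. if up then k \<le> m else m < (k::nat)"
  have geo: "(\<integral>\<^sup>+k. of_bool (?R m k) * ennreal (t ^ (k - 1)) \<partial>pos_count) =
    ennreal ((if up then 1 - t ^ m else t ^ m) / (1 - t))" for m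
    using geometric_tail[OF t, of m] geometric_initial[OF t, of m] by (cases up) simp_all
  have "push lborel (step_kernel up form1) D t =
    (\<integral>\<^sup>+m. c m * ennreal ((if up then 1 - t ^ m else t ^ m) / real m) * ennreal (1 / (1 - t)) \<partial>pos_count)"
    using t by (subst push_step_kernel[OF assms]) (auto simp: form1_def nn_integral_multc)
  also have "\<dots> = (\<integral>\<^sup>+m. c m * ennreal (1 / real m) *
      ennreal ((if up then 1 - t ^ m else t ^ m) / (1 - t)) \<partial>pos_count)"
  proof (rule nn_integral_cong)
    fix m assume "m \<in> space pos_count"
    have "t ^ m \<le> 1"
      using t by (intro power_le_one) auto
    then have "ennreal ((if up then 1 - t ^ m else t ^ m) / real m) * ennreal (1 / (1 - t)) =
      ennreal (1 / real m) * ennreal ((if up then 1 - t ^ m else t ^ m) / (1 - t))"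
      using t by (subst (1 2) ennreal_mult[symmetric]) auto
    then show "c m * ennreal ((if up then 1 - t ^ m else t ^ m) / real m) * ennreal (1 / (1 - t)) =
      c m * ennreal (1 / real m) * ennreal ((if up then 1 - t ^ m else t ^ m) / (1 - t))"
      by (simp add: mult.assoc)
  qed
  also have "\<dots> = (\<integral>\<^sup>+m. \<integral>\<^sup>+k. c m * ennreal (1 / real m) *
      (of_bool (?R m k) * ennreal (t ^ (k - 1))) \<partial>pos_count \<partial>pos_count)"
    unfolding geo[symmetric] by (intro nn_integral_cong nn_integral_cmult[symmetric]) simp
  also have "\<dots> = (\<integral>\<^sup>+k. \<integral>\<^sup>+m. c m * ennreal (1 / real m) *
      (of_bool (?R m k) * ennreal (t ^ (k - 1))) \<partial>pos_count \<partial>pos_count)"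
    by (rule nn_integral_pos_count_swap)
  also have "\<dots> = (\<integral>\<^sup>+k. (\<integral>\<^sup>+m. c m * ennreal (1 / real m) * of_bool (?R m k) \<partial>pos_count) *
      ennreal (t ^ (k - 1)) \<partial>pos_count)"
    by (intro nn_integral_cong) (simp add: nn_integral_multc[symmetric] mult.assoc)
  finally show "push lborel (step_kernel up form1) D t = \<dots>" .
qed (auto simp: push_def step_kernel_def form1_def)

section \<open>One box is one block of variables\<close>

text \<open>This says that $D(t) = \sum_m c_m m t^{m-1}$. It is expressed with the coefficients
$c'_m = m c_m$, which avoids cancelling $m$ in the extended nonnegative reals.\<close>

definition box_series :: "(real \<Rightarrow> ennreal) \<Rightarrow> (nat \<Rightarrow> ennreal) \<Rightarrow> bool" where
  "box_series D c \<longleftrightarrow> (\<exists>c'. density_series D c' \<and> (\<forall>m. c' m * ennreal (1 / real m) = c m))"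

lemma density_series_fold_form0:
  assumes "density_series D c"
    and "\<And>u. u \<in> set l \<Longrightarrow> \<kappa> u = step_kernel False form0"
  shows "density_series (fold (\<lambda>u. push lborel (\<kappa> u)) l D)
    (\<lambda>m. c m * ennreal (1 / real m) ^ length l)"
  using assms
proof (induction l arbitrary: D c)
  case (Cons u l)
  have "density_series (push lborel (\<kappa> u) D) (\<lambda>m. c m * ennreal (1 / real m))"
    using Cons.prems density_series_push_form0 by auto
  from Cons.IH[OF this] Cons.prems show ?case
    by (simp add: mult.assoc)
qed simp

lemma box_series_start:
  assumes "\<And>u. u \<in> set l \<Longrightarrow> \<kappa> u = step_kernel False form0"
  shows "box_series (fold (\<lambda>u. push lborel (\<kappa> u)) l form1) (\<lambda>k. ennreal (1 / real k) ^ Suc (length l))"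
  unfolding box_series_def
  by (intro exI[of _ "\<lambda>m. 1 * ennreal (1 / real m) ^ length l"] conjI density_series_fold_form0 assms)
     (auto intro: density_series_form1 simp: mult.commute)

text \<open>The factor contributed to a term of the sum by a box with entry \<open>k\<close> and exponent \<open>e\<close>, reached from
a box with entry \<open>m\<close>.\<close>

definition box_kernel :: "bool \<Rightarrow> nat \<Rightarrow> nat \<Rightarrow> nat \<Rightarrow> ennreal" where
  "box_kernel left e m k = of_bool (if left then k \<le> m else m < k) * ennreal (1 / real k) ^ e"

text \<open>The first variable of the block turns the sum over \<open>m\<close> into the coefficients, and each of the
\<open>length l\<close> others, as well as the passage from \<open>c'\<close> to \<open>c\<close>, gives one factor \<open>1 / k\<close>.\<close>

lemma box_series_step:
  assumes "box_series D c" "\<kappa> u = step_kernel left form1"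
    and "\<And>u. u \<in> set l \<Longrightarrow> \<kappa> u = step_kernel False form0"
  shows "box_series (fold (\<lambda>u. push lborel (\<kappa> u)) (u # l) D)
    (push pos_count (box_kernel left (Suc (length l))) c)"
proof -
  obtain c' where c': "density_series D c'" "\<And>m. c' m * ennreal (1 / real m) = c m"
    using assms(1) by (auto simp: box_series_def)
  have 1: "density_series (push lborel (step_kernel left form1) D)
    (\<lambda>k. \<integral>\<^sup>+m. c m * of_bool (if left then k \<le> m else m < k) \<partial>pos_count)"
    using density_series_push_form1[OF c'(1)] unfolding c'(2) .
  have 2: "(\<integral>\<^sup>+m. c m * of_bool (if left then k \<le> m else m < k) \<partial>pos_count) *
      ennreal (1 / real k) ^ length l * ennreal (1 / real k) =
    push pos_count (box_kernel left (Suc (length l))) c k" for k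
  proof -
    have "(\<integral>\<^sup>+m. c m * of_bool (if left then k \<le> m else m < k) \<partial>pos_count) *
        (ennreal (1 / real k) ^ Suc (length l)) = push pos_count (box_kernel left (Suc (length l))) c k"
      unfolding push_def box_kernel_def by (subst nn_integral_multc[symmetric]) (simp_all only: mult_ac, simp)
    then show ?thesis
      by (simp add: mult_ac)
  qed
  show ?thesis
    unfolding box_series_def
  proof (intro exI conjI)
    show "density_series (fold (\<lambda>u. push lborel (\<kappa> u)) (u # l) D)
      (\<lambda>k. (\<integral>\<^sup>+m. c m * of_bool (if left then k \<le> m else m < k) \<partial>pos_count) *
        ennreal (1 / real k) ^ length l)"
      using density_series_fold_form0[where l = l and \<kappa> = \<kappa>, OF 1 assms(3)] assms(2) by simp
  qed (use 2 in blast)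
qed

lemma box_series_fold:
  fixes vars :: "'b \<Rightarrow> 'v list"
  assumes "box_series D c"
    and "\<And>v. v \<in> set L \<Longrightarrow> vars v \<noteq> [] \<and> length (vars v) = e v"
    and "\<And>v. v \<in> set L \<Longrightarrow> \<kappa> (hd (vars v)) = step_kernel (left v) form1"
    and "\<And>v u. v \<in> set L \<Longrightarrow> u \<in> set (tl (vars v)) \<Longrightarrow> \<kappa> u = step_kernel False form0"
  shows "box_series (fold (\<lambda>u. push lborel (\<kappa> u)) (concat (map vars L)) D)
    (fold (\<lambda>v. push pos_count (box_kernel (left v) (e v))) L c)"
  using assms
proof (induction L arbitrary: D c)
  case (Cons v L)
  obtain u us where u: "vars v = u # us"
    using Cons.prems(2)[of v] by (cases "vars v") auto
  have e: "e v = Suc (length us)"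
    using Cons.prems(2)[of v] u by auto
  have "box_series (fold (\<lambda>u. push lborel (\<kappa> u)) (vars v) D) (push pos_count (box_kernel (left v) (e v)) c)"
    unfolding u e
    using Cons.prems(3,4)[of v] u by (intro box_series_step Cons.prems(1)) auto
  then have "box_series (fold (\<lambda>u. push lborel (\<kappa> u)) (concat (map vars L))
      (fold (\<lambda>u. push lborel (\<kappa> u)) (vars v) D))
    (fold (\<lambda>v. push pos_count (box_kernel (left v) (e v))) L (push pos_count (box_kernel (left v) (e v)) c))"
    using Cons.prems(2-) by (intro Cons.IH) auto
  then show ?case
    by simp
qed simp

lemma box_series_integral:
  assumes "box_series D c"
  shows "(\<integral>\<^sup>+t. D t \<partial>lborel) = (\<integral>\<^sup>+m. c m \<partial>pos_count)"
proof -
  obtain c' where c': "density_series D c'" "\<And>m. c' m * ennreal (1 / real m) = c m"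
    using assms(1) by (auto simp: box_series_def)
  have "(\<integral>\<^sup>+t. D t \<partial>lborel) = (\<integral>\<^sup>+t. D t * indicator UNIV t \<partial>lborel)"
    by simp
  also have "\<dots> = (\<integral>\<^sup>+m. c' m * ennreal ((1 ^ m - 0 ^ m) / real m) \<partial>pos_count)"
    by (rule density_series_integral_01[OF c'(1)]) auto
  also have "\<dots> = (\<integral>\<^sup>+m. c m \<partial>pos_count)"
    by (rule nn_integral_cong) (auto simp: c'(2)[symmetric] power_0_left)
  finally show ?thesis .
qed

text \<open>The chain of variables is cut into the blocks \<open>vars v\<close>, one for each box \<open>v\<close>. The first box is
treated apart since it is reached by no step: its block starts from the weight
$1/(1-t) = \sum_m t^{m-1}$.\<close>

theorem chain_integral_eq_chain_sum:
  fixes vars :: "'b \<Rightarrow> 'v list"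
  assumes vars: "\<And>v. v \<in> set (b # L) \<Longrightarrow> vars v \<noteq> [] \<and> length (vars v) = e v"
    and \<kappa>_hd: "\<And>v. v \<in> set L \<Longrightarrow> \<kappa> (hd (vars v)) = step_kernel (left v) form1"
    and \<kappa>_tl: "\<And>v u. v \<in> set (b # L) \<Longrightarrow> u \<in> set (tl (vars v)) \<Longrightarrow> \<kappa> u = step_kernel False form0"
    and dist: "distinct (b # L)" "distinct (concat (map vars (b # L)))"
    and V: "concat (map vars (b # L)) = u # V"
  shows "(\<integral>\<^sup>+z. form1 (z u) * chain_weight \<kappa> u V z \<partial>Pi\<^sub>M (set (u # V)) (\<lambda>_. lborel)) =
    (\<integral>\<^sup>+m. ennreal (1 / real (m b)) ^ e b *
      chain_weight (\<lambda>v. box_kernel (left v) (e v)) b L m \<partial>Pi\<^sub>M (set (b # L)) (\<lambda>_. pos_count))"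
proof -
  obtain us where us: "vars b = u # us" "V = us @ concat (map vars L)"
    using vars[of b] V by (cases "vars b") auto
  have e: "e b = Suc (length us)"
    using vars[of b] us by simp
  have \<kappa>: "\<exists>up. \<kappa> w = step_kernel up form1 \<or> \<kappa> w = step_kernel up form0" if "w \<in> set V" for w
  proof -
    from that us consider "w \<in> set us" | v where "v \<in> set L" "w \<in> set (vars v)"
      by auto
    then show ?thesis
    proof cases
      case 1
      then show ?thesis
        using \<kappa>_tl[of b w] us by auto
    next
      case 2
      then have "w = hd (vars v) \<or> w \<in> set (tl (vars v))"
        by (cases "vars v") auto
      then show ?thesis
        using \<kappa>_hd[of v] \<kappa>_tl[of v w] 2 by auto
    qed
  qed
  have "(\<integral>\<^sup>+z. form1 (z u) * chain_weight \<kappa> u V z \<partial>Pi\<^sub>M (set (u # V)) (\<lambda>_. lborel)) =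
    (\<integral>\<^sup>+t. fold (\<lambda>w. push lborel (\<kappa> w)) V form1 t \<partial>lborel)"
  proof (rule nn_integral_chain)
    show "case_prod (\<kappa> w) \<in> borel_measurable (lborel \<Otimes>\<^sub>M lborel)" if "w \<in> set V" for w
    proof -
      have "case_prod (\<kappa> w) \<in> borel_measurable (borel \<Otimes>\<^sub>M borel)"
        using \<kappa>[OF that] by auto
      then show ?thesis
        by (simp cong: measurable_cong_sets sets_pair_measure_cong)
    qed
    show "distinct (u # V)"
      using dist(2) unfolding V .
  qed (auto intro: lborel.sigma_finite_measure_axioms)
  also have "\<dots> = (\<integral>\<^sup>+k. fold (\<lambda>v. push pos_count (box_kernel (left v) (e v))) L
      (\<lambda>k. ennreal (1 / real k) ^ e b) k \<partial>pos_count)"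
  proof (rule box_series_integral)
    have "box_series (fold (\<lambda>w. push lborel (\<kappa> w)) us form1) (\<lambda>k. ennreal (1 / real k) ^ e b)"
      unfolding e using \<kappa>_tl[of b] us by (intro box_series_start) auto
    then have "box_series (fold (\<lambda>w. push lborel (\<kappa> w)) (concat (map vars L)) (fold (\<lambda>w. push lborel (\<kappa> w)) us form1))
      (fold (\<lambda>v. push pos_count (box_kernel (left v) (e v))) L (\<lambda>k. ennreal (1 / real k) ^ e b))"
      using vars \<kappa>_hd \<kappa>_tl by (intro box_series_fold) auto
    then show "box_series (fold (\<lambda>w. push lborel (\<kappa> w)) V form1)
      (fold (\<lambda>v. push pos_count (box_kernel (left v) (e v))) L (\<lambda>k. ennreal (1 / real k) ^ e b))"
      by (simp add: us)
  qed
  also have "\<dots> = (\<integral>\<^sup>+m. ennreal (1 / real (m b)) ^ e b *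
      chain_weight (\<lambda>v. box_kernel (left v) (e v)) b L m \<partial>Pi\<^sub>M (set (b # L)) (\<lambda>_. pos_count))"
  proof (rule nn_integral_chain[symmetric])
    show "sigma_finite_measure pos_count"
      by (rule sigma_finite_measure_count_space)
    show "case_prod (box_kernel (left v) (e v)) \<in> borel_measurable (pos_count \<Otimes>\<^sub>M pos_count)" for v
      by (subst pair_measure_countable) auto
  qed (use dist in auto)
  finally show ?thesis .
qed

section \<open>Convergence\<close>

lemma sum_inverse_sqrt_le: "(\<Sum>n<N. 1 / sqrt (real (Suc n))) \<le> 2 * sqrt (real N)"
proof (induction N)
  case (Suc N)
  define a where "a = sqrt (real N)"
  define b where "b = sqrt (real (Suc N))"
  have ab: "0 \<le> a" "0 < b" "a ^ 2 = real N" "b ^ 2 = real N + 1"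
    by (simp_all add: a_def b_def)
  have "2 * a * b \<le> a ^ 2 + b ^ 2"
    using sum_squares_bound[of a b] by simp
  then have "2 * a + 1 / b \<le> 2 * b"
    using ab by (simp add: field_simps power2_eq_square)
  then show ?case
    using Suc.IH by (simp add: a_def b_def)
qed simp

text \<open>A telescoping majorant of $n^{-3/2}$. With $a = \sqrt n$ and $b = \sqrt{n+1}$ the right-hand side is
$4/(ab(a+b))$, and $b^2 \le 2a^2$ gives $b(a+b) \le 4a^2$.\<close>

lemma inverse_sqrt_cube_le_diff:
  assumes "1 \<le> (n::nat)"
  shows "1 / (real n * sqrt (real n)) \<le> 4 / sqrt (real n) - 4 / sqrt (real (Suc n))"
proof -
  define a where "a = sqrt (real n)"
  define b where "b = sqrt (real (Suc n))"
  have ab: "0 < a" "0 < b" "a ^ 2 = real n" "b ^ 2 = real n + 1"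
    using assms by (simp_all add: a_def b_def)
  have "b ^ 2 \<le> 2 * a ^ 2"
    unfolding ab using assms by simp
  moreover from this have "b \<le> 2 * a"
    using ab by (intro power2_le_imp_le[of b "2 * a"]) (auto simp: power_mult_distrib)
  then have "a * b \<le> a * (2 * a)"
    using ab by (intro mult_left_mono) auto
  ultimately have "b * (a + b) \<le> 4 * a ^ 2"
    by (simp add: power2_eq_square algebra_simps)
  then have "4 / (4 * a ^ 2 * a) \<le> 4 / (b * (a + b) * a)"
    using ab(1,2) by (intro divide_left_mono mult_right_mono) auto
  then have "1 / (a ^ 2 * a) \<le> 4 / (a * b * (a + b))"
    by (simp add: mult_ac)
  also have "4 / (a * b * (a + b)) = 4 * (b ^ 2 - a ^ 2) / (a * b * (a + b))"
    by (simp add: ab)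
  also have "b ^ 2 - a ^ 2 = (b - a) * (a + b)"
    by (simp add: power2_eq_square algebra_simps)
  also have "4 * ((b - a) * (a + b)) / (a * b * (a + b)) = 4 * (b - a) / (a * b)"
    using ab(1,2) by simp
  also have "\<dots> = 4 / a - 4 / b"
    using ab(1,2) by (simp add: field_simps)
  finally show ?thesis
    unfolding ab(3) by (simp only: a_def b_def)
qed

lemma pos_count_inverse_sqrt_le:
  "(\<integral>\<^sup>+m. ennreal (1 / sqrt (real m)) * of_bool (m < k) \<partial>pos_count) \<le> ennreal (2 * sqrt (real k))"
proof -
  have "(\<integral>\<^sup>+m. ennreal (1 / sqrt (real m)) * of_bool (m < k) \<partial>pos_count) =
    (\<Sum>n<k. ennreal (1 / sqrt (real (Suc n))) * of_bool (Suc n < k))"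
    unfolding nn_integral_pos_count by (rule suminf_finite) auto
  also have "\<dots> \<le> (\<Sum>n<k. ennreal (1 / sqrt (real (Suc n))))"
    by (intro sum_mono) auto
  also have "\<dots> = ennreal (\<Sum>n<k. 1 / sqrt (real (Suc n)))"
    by (intro sum_ennreal) auto
  also have "\<dots> \<le> ennreal (2 * sqrt (real k))"
    by (intro ennreal_leI sum_inverse_sqrt_le)
  finally show ?thesis .
qed

lemma pos_count_inverse_sqrt_cube_le:
  assumes "1 \<le> k"
  shows "(\<integral>\<^sup>+m. ennreal (1 / (real m * sqrt (real m))) * of_bool (k \<le> m) \<partial>pos_count) \<le>
    ennreal (4 / sqrt (real k))"
proof -
  \<comment> \<open>The maximum makes the telescoping differences vanish for the indices below \<open>k\<close>.\<close>
  define g where "g n = 4 / sqrt (real (max k n))" for n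
  have g: "of_bool (k \<le> n) * (1 / (real n * sqrt (real n))) \<le> g n - g (Suc n)" if "1 \<le> n" for n
  proof (cases "k \<le> n")
    case True
    then show ?thesis
      using inverse_sqrt_cube_le_diff[OF that] by (simp add: g_def max_def)
  next
    case False
    then have "max k n = k" "max k (Suc n) = k"
      by auto
    then show ?thesis
      using False by (simp add: g_def)
  qed
  have "(\<Sum>n<N. ennreal (1 / (real (Suc n) * sqrt (real (Suc n)))) * of_bool (k \<le> Suc n)) \<le>
    ennreal (4 / sqrt (real k))" for N
  proof -
    have "(\<Sum>n<N. ennreal (1 / (real (Suc n) * sqrt (real (Suc n)))) * of_bool (k \<le> Suc n)) =
      (\<Sum>n<N. ennreal (of_bool (k \<le> Suc n) * (1 / (real (Suc n) * sqrt (real (Suc n))))))"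
      by (intro sum.cong) auto
    also have "\<dots> = ennreal (\<Sum>n<N. of_bool (k \<le> Suc n) * (1 / (real (Suc n) * sqrt (real (Suc n)))))"
      by (intro sum_ennreal) auto
    also have "\<dots> \<le> ennreal (\<Sum>n<N. g (Suc n) - g (Suc (Suc n)))"
      by (intro ennreal_leI sum_mono g) auto
    also have "(\<Sum>n<N. g (Suc n) - g (Suc (Suc n))) = g 1 - g (Suc N)"
      by (subst sum_lessThan_telescope') simp
    also have "\<dots> \<le> 4 / sqrt (real k)"
      using assms by (simp add: g_def max_def)
    finally show ?thesis
      by (simp add: ennreal_leI)
  qed
  then show ?thesis
    unfolding nn_integral_pos_count suminf_eq_SUP by (intro SUP_least)
qed

text \<open>The two growth rates $m^{-1/2}$ and $m^{-3/2}$. The first one holds along columns, also with all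
exponents 1, and the second is what the sums over $m \ge k$ in a row need. The more natural rate $m^{-1}$ is not
preserved along a column, where each further box with exponent 1 brings a factor $\log m$; the
additional factor $m^{1/2}$ in both rates absorbs these logarithms.\<close>

definition leg_bounded :: "(nat \<Rightarrow> ennreal) \<Rightarrow> bool" where
  "leg_bounded c \<longleftrightarrow> (\<exists>C\<ge>0. \<forall>m\<ge>1. c m \<le> ennreal C * ennreal (1 / sqrt (real m)))"
definition row_bounded :: "(nat \<Rightarrow> ennreal) \<Rightarrow> bool" where
  "row_bounded c \<longleftrightarrow> (\<exists>C\<ge>0. \<forall>m\<ge>1. c m \<le> ennreal C * ennreal (1 / (real m * sqrt (real m))))"

lemma inverse_power_le:
  assumes "1 \<le> k" "j \<le> e"
  shows "ennreal (1 / real k) ^ e \<le> ennreal (1 / real k ^ j)"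
proof -
  have "(1 / real k) ^ e \<le> (1 / real k) ^ j"
    using assms by (intro power_decreasing) auto
  then show ?thesis
    by (simp add: ennreal_power power_divide ennreal_leI)
qed

lemma row_bounded_imp_leg_bounded:
  assumes "row_bounded c"
  shows "leg_bounded c"
proof -
  obtain C where C: "0 \<le> C" "\<And>m. 1 \<le> m \<Longrightarrow> c m \<le> ennreal C * ennreal (1 / (real m * sqrt (real m)))"
    using assms by (auto simp: row_bounded_def)
  have "c m \<le> ennreal C * ennreal (1 / sqrt (real m))" if "1 \<le> m" for m
  proof -
    have "1 / (real m * sqrt (real m)) \<le> 1 / sqrt (real m)"
      using that by (intro divide_left_mono) auto
    then show ?thesis
      using C(2)[OF that] by (meson ennreal_leI mult_left_mono order_trans zero_le)
  qed
  with C(1) show ?thesis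
    unfolding leg_bounded_def by auto
qed

lemma bounded_start:
  "1 \<le> e \<Longrightarrow> leg_bounded (\<lambda>k. ennreal (1 / real k) ^ e)"
  "2 \<le> e \<Longrightarrow> row_bounded (\<lambda>k. ennreal (1 / real k) ^ e)"
proof -
  have sq: "sqrt (real k) \<le> real k" if "1 \<le> k" for k :: nat
    using that by (intro real_le_lsqrt) (auto simp: power2_eq_square)
  show "leg_bounded (\<lambda>k. ennreal (1 / real k) ^ e)" if "1 \<le> e"
    unfolding leg_bounded_def
  proof (intro exI[of _ 1] conjI allI impI)
    fix k :: nat assume k: "1 \<le> k"
    have "1 / real k ^ 1 \<le> 1 / sqrt (real k)"
      using k sq[OF k] by (simp add: frac_le)
    then show "ennreal (1 / real k) ^ e \<le> ennreal 1 * ennreal (1 / sqrt (real k))"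
      using inverse_power_le[OF k that] by (simp add: ennreal_leI order_trans)
  qed simp
  show "row_bounded (\<lambda>k. ennreal (1 / real k) ^ e)" if "2 \<le> e"
    unfolding row_bounded_def
  proof (intro exI[of _ 1] conjI allI impI)
    fix k :: nat assume k: "1 \<le> k"
    have "1 / real k ^ 2 \<le> 1 / (real k * sqrt (real k))"
      using k sq[OF k] by (simp add: frac_le power2_eq_square)
    then show "ennreal (1 / real k) ^ e \<le> ennreal 1 * ennreal (1 / (real k * sqrt (real k)))"
      using inverse_power_le[OF k that] by (simp add: ennreal_leI order_trans)
  qed simp
qed

text \<open>Only \<open>j\<close> of the \<open>e\<close> factors \<open>1 / k\<close> are kept, so that larger exponents need no separate treatment.\<close>

lemma push_box_kernel_le:
  assumes "0 \<le> C" and c: "\<And>m. 1 \<le> m \<Longrightarrow> c m \<le> ennreal C * w m"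
    and w: "(\<integral>\<^sup>+m. w m * of_bool (if left then k \<le> m else m < k) \<partial>pos_count) \<le> ennreal B"
    and "1 \<le> k" "j \<le> e" "0 \<le> B"
  shows "push pos_count (box_kernel left e) c k \<le> ennreal C * ennreal (B / real k ^ j)"
proof -
  let ?R = "\<lambda>m. of_bool (if left then k \<le> m else m < k) :: ennreal"
  have "push pos_count (box_kernel left e) c k \<le>
    (\<integral>\<^sup>+m. ennreal C * (w m * ?R m) * ennreal (1 / real k ^ j) \<partial>pos_count)"
    unfolding push_def box_kernel_def
  proof (rule nn_integral_mono)
    fix m assume "m \<in> space pos_count"
    then have "c m * (?R m * ennreal (1 / real k) ^ e) \<le> ennreal C * w m * (?R m * ennreal (1 / real k ^ j))"
      by (intro mult_mono c inverse_power_le assms) auto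
    then show "c m * (?R m * ennreal (1 / real k) ^ e) \<le> ennreal C * (w m * ?R m) * ennreal (1 / real k ^ j)"
      by (simp only: mult.assoc)
  qed
  also have "\<dots> = ennreal C * (\<integral>\<^sup>+m. w m * ?R m \<partial>pos_count) * ennreal (1 / real k ^ j)"
    by (simp add: nn_integral_multc nn_integral_cmult)
  also have "\<dots> \<le> ennreal C * ennreal B * ennreal (1 / real k ^ j)"
    by (intro mult_right_mono mult_left_mono w) auto
  also have "\<dots> = ennreal C * ennreal (B / real k ^ j)"
    using \<open>0 \<le> B\<close> by (simp add: mult.assoc ennreal_mult[symmetric])
  finally show ?thesis .
qed

text \<open>Since $\sum_{m<k} m^{-1/2} = O(k^{1/2})$, one factor $1/k$ restores the rate $k^{-1/2}$, and two
give the rate $k^{-3/2}$.\<close>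

lemma leg_bounded_push_less:
  assumes "leg_bounded c"
  shows "1 \<le> e \<Longrightarrow> leg_bounded (push pos_count (box_kernel False e) c)"
    and "2 \<le> e \<Longrightarrow> row_bounded (push pos_count (box_kernel False e) c)"
proof -
  obtain C where C: "0 \<le> C" "\<And>m. 1 \<le> m \<Longrightarrow> c m \<le> ennreal C * ennreal (1 / sqrt (real m))"
    using assms by (auto simp: leg_bounded_def)
  have *: "push pos_count (box_kernel False e) c k \<le> ennreal C * ennreal (2 * sqrt (real k) / real k ^ j)"
    if "1 \<le> k" "j \<le> e" for j k
    using pos_count_inverse_sqrt_le[of k] C that by (intro push_box_kernel_le) auto
  have sq: "sqrt (real k) / real k = 1 / sqrt (real k)" if "1 \<le> k" for k :: nat
    using that by (simp add: field_simps)
  have C2: "ennreal C * ennreal (2 * x) = ennreal (2 * C) * ennreal x" if "0 \<le> x" for x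
    using C(1) that by (simp add: ennreal_mult[symmetric] mult_ac)
  show "leg_bounded (push pos_count (box_kernel False e) c)" if "1 \<le> e"
    unfolding leg_bounded_def
  proof (intro exI[of _ "2 * C"] conjI allI impI)
    fix k :: nat assume k: "1 \<le> k"
    have "2 * sqrt (real k) / real k ^ 1 = 2 * (1 / sqrt (real k))"
      using sq[OF k] by simp
    then show "push pos_count (box_kernel False e) c k \<le> ennreal (2 * C) * ennreal (1 / sqrt (real k))"
      using *[OF k that] C2[of "1 / sqrt (real k)"] by simp
  qed (use C in simp)
  show "row_bounded (push pos_count (box_kernel False e) c)" if "2 \<le> e"
    unfolding row_bounded_def
  proof (intro exI[of _ "2 * C"] conjI allI impI)
    fix k :: nat assume k: "1 \<le> k"
    have "2 * sqrt (real k) / real k ^ 2 = 2 * ((sqrt (real k) / real k) / real k)"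
      by (simp add: power2_eq_square)
    also have "\<dots> = 2 * (1 / (real k * sqrt (real k)))"
      unfolding sq[OF k] by simp
    finally show "push pos_count (box_kernel False e) c k \<le>
      ennreal (2 * C) * ennreal (1 / (real k * sqrt (real k)))"
      using *[OF k that] C2[of "1 / (real k * sqrt (real k))"] by simp
  qed (use C in simp)
qed

text \<open>Since $\sum_{m\ge k} m^{-3/2} = O(k^{-1/2})$, one factor $1/k$ restores the rate $k^{-3/2}$.\<close>

lemma row_bounded_push_left:
  assumes "row_bounded c" "1 \<le> e"
  shows "row_bounded (push pos_count (box_kernel True e) c)"
proof -
  obtain C where C: "0 \<le> C" "\<And>m. 1 \<le> m \<Longrightarrow> c m \<le> ennreal C * ennreal (1 / (real m * sqrt (real m)))"
    using assms by (auto simp: row_bounded_def)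
  show ?thesis
    unfolding row_bounded_def
  proof (intro exI[of _ "4 * C"] conjI allI impI)
    fix k :: nat assume k: "1 \<le> k"
    have "push pos_count (box_kernel True e) c k \<le> ennreal C * ennreal (4 / sqrt (real k) / real k ^ 1)"
      using pos_count_inverse_sqrt_cube_le[OF k] C k assms by (intro push_box_kernel_le) auto
    also have "\<dots> = ennreal (4 * C) * ennreal (1 / (real k * sqrt (real k)))"
      using C(1) by (simp add: ennreal_mult[symmetric] mult_ac)
    finally show "push pos_count (box_kernel True e) c k \<le>
      ennreal (4 * C) * ennreal (1 / (real k * sqrt (real k)))" .
  qed (use C in simp)
qed

lemma row_bounded_finite:
  assumes "row_bounded c"
  shows "(\<integral>\<^sup>+m. c m \<partial>pos_count) < \<infinity>"
proof -
  obtain C where C: "0 \<le> C" "\<And>m. 1 \<le> m \<Longrightarrow> c m \<le> ennreal C * ennreal (1 / (real m * sqrt (real m)))"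
    using assms by (auto simp: row_bounded_def)
  have "(\<integral>\<^sup>+m. c m \<partial>pos_count) \<le>
    (\<integral>\<^sup>+m. ennreal C * (ennreal (1 / (real m * sqrt (real m))) * of_bool (1 \<le> m)) \<partial>pos_count)"
    using C(2) by (intro nn_integral_mono) auto
  also have "\<dots> = ennreal C * (\<integral>\<^sup>+m. ennreal (1 / (real m * sqrt (real m))) * of_bool (1 \<le> m) \<partial>pos_count)"
    by (intro nn_integral_cmult) simp
  also have "\<dots> \<le> ennreal C * ennreal (4 / sqrt (real 1))"
    by (intro mult_left_mono pos_count_inverse_sqrt_cube_le) auto
  also have "\<dots> < \<infinity>"
    by (simp add: ennreal_mult_less_top)
  finally show ?thesis .
qed

text \<open>The better rate holds at a box that has exponent at least 2 or is reached by a step to the left.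
In particular, it is available before each step to the left.\<close>

lemma bounded_fold:
  assumes "leg_bounded c" "left b \<or> 2 \<le> e b \<Longrightarrow> row_bounded c"
    and "\<And>v. v \<in> set L \<Longrightarrow> 1 \<le> (e v :: nat)"
    and "successively (\<lambda>u v. left v \<longrightarrow> left u \<or> 2 \<le> e u) (b # L)"
    and "left (last (b # L)) \<or> 2 \<le> e (last (b # L))"
  shows "row_bounded (fold (\<lambda>v. push pos_count (box_kernel (left v) (e v))) L c)"
  using assms
proof (induction L arbitrary: b c)
  case (Cons v L)
  let ?c = "push pos_count (box_kernel (left v) (e v)) c"
  have e: "1 \<le> e v"
    using Cons.prems by auto
  have row: "row_bounded ?c" if "left v \<or> 2 \<le> e v"
  proof (cases "left v")
    case True
    then show ?thesis
      using row_bounded_push_left[OF Cons.prems(2) e] Cons.prems(4) by auto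
  next
    case False
    then show ?thesis
      using leg_bounded_push_less(2)[OF Cons.prems(1)] that by auto
  qed
  have leg: "leg_bounded ?c"
  proof (cases "left v")
    case True
    then show ?thesis
      using row row_bounded_imp_leg_bounded by auto
  next
    case False
    then show ?thesis
      using leg_bounded_push_less(1)[OF Cons.prems(1) e] by auto
  qed
  have "row_bounded (fold (\<lambda>v. push pos_count (box_kernel (left v) (e v))) L ?c)"
    by (rule Cons.IH[where b = v]) (use leg row Cons.prems in auto)
  then show ?case
    by simp
qed auto

theorem chain_sum_finite:
  assumes "distinct (b # L)"
    and "\<And>v. v \<in> set (b # L) \<Longrightarrow> 1 \<le> e v" "\<not> left b"
    and "successively (\<lambda>u v. left v \<longrightarrow> left u \<or> 2 \<le> e u) (b # L)"
    and "left (last (b # L)) \<or> 2 \<le> e (last (b # L))"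
  shows "(\<integral>\<^sup>+m. ennreal (1 / real (m b)) ^ e b *
      chain_weight (\<lambda>v. box_kernel (left v) (e v)) b L m \<partial>Pi\<^sub>M (set (b # L)) (\<lambda>_. pos_count)) < \<infinity>"
proof -
  have "(\<integral>\<^sup>+m. ennreal (1 / real (m b)) ^ e b *
      chain_weight (\<lambda>v. box_kernel (left v) (e v)) b L m \<partial>Pi\<^sub>M (set (b # L)) (\<lambda>_. pos_count)) =
    (\<integral>\<^sup>+k. fold (\<lambda>v. push pos_count (box_kernel (left v) (e v))) L
      (\<lambda>k. ennreal (1 / real k) ^ e b) k \<partial>pos_count)"
  proof (rule nn_integral_chain)
    show "sigma_finite_measure pos_count"
      by (rule sigma_finite_measure_count_space)
    show "case_prod (box_kernel (left v) (e v)) \<in> borel_measurable (pos_count \<Otimes>\<^sub>M pos_count)" for v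
      by (subst pair_measure_countable) auto
  qed (use assms in auto)
  also have "\<dots> < \<infinity>"
  proof (intro row_bounded_finite bounded_fold[where b = b])
    show "leg_bounded (\<lambda>k. ennreal (1 / real k) ^ e b)"
      using assms(2)[of b] by (intro bounded_start) auto
    show "row_bounded (\<lambda>k. ennreal (1 / real k) ^ e b)" if "left b \<or> 2 \<le> e b"
      using that assms(3) by (intro bounded_start) auto
  qed (use assms in auto)
  finally show ?thesis .
qed

section \<open>Ribbons as lattice paths\<close>

definition ribbon_step :: "box \<Rightarrow> box \<Rightarrow> bool" where
  "ribbon_step b b' \<longleftrightarrow> (fst b' = fst b \<and> snd b = Suc (snd b')) \<or> (fst b' = Suc (fst b) \<and> snd b' = snd b)"

text \<open>On a ribbon, the row tells the two kinds of steps apart.\<close>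

definition box_order :: "(box \<Rightarrow> nat) \<Rightarrow> box \<Rightarrow> box \<Rightarrow> bool" where
  "box_order m b b' \<longleftrightarrow> (if fst b' = fst b then m b' \<le> m b else m b < m b')"

text \<open>A path that only goes left and down never comes back. Hence its boxes in one row or in one column
are consecutive, which is why inequalities between neighbours suffice below.\<close>

lemma ribbon_path_antitone:
  assumes "successively ribbon_step (b # bs)" "b' \<in> set bs"
  shows "fst b \<le> fst b' \<and> snd b' \<le> snd b \<and> b' \<noteq> b"
  using assms
proof (induction bs arbitrary: b)
  case (Cons c bs)
  have step: "ribbon_step b c" and path: "successively ribbon_step (c # bs)"
    using Cons.prems by auto
  show ?case
  proof (cases "b' = c")
    case True
    then show ?thesis
      using step by (auto simp: ribbon_step_def)
  next
    case False
    then have "fst c \<le> fst b' \<and> snd b' \<le> snd c"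
      using Cons.IH[OF path] Cons.prems by auto
    then show ?thesis
      using step by (auto simp: ribbon_step_def)
  qed
qed simp

lemma ribbon_path_distinct:
  assumes "successively ribbon_step bs"
  shows "distinct bs"
  using assms
proof (induction bs)
  case (Cons b bs)
  then show ?case
    using ribbon_path_antitone[OF Cons.prems, of b] by (auto simp: successively_Cons)
qed simp

lemma ribbon_path_order_head:
  assumes "successively ribbon_step (b # bs)" "successively (box_order m) (b # bs)" "b' \<in> set bs"
  shows "(fst b' = fst b \<longrightarrow> m b' \<le> m b) \<and> (snd b' = snd b \<longrightarrow> m b < m b')"
  using assms
proof (induction bs arbitrary: b)
  case (Cons c bs)
  have step: "ribbon_step b c" "box_order m b c" and path: "successively ribbon_step (c # bs)"
    "successively (box_order m) (c # bs)"
    using Cons.prems by auto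
  show ?case
  proof (cases "b' = c")
    case True
    then show ?thesis
      using step by (auto simp: ribbon_step_def box_order_def)
  next
    case False
    then have "b' \<in> set bs"
      using Cons.prems by auto
    then have "(fst b' = fst c \<longrightarrow> m b' \<le> m c) \<and> (snd b' = snd c \<longrightarrow> m c < m b')"
      "fst c \<le> fst b' \<and> snd b' \<le> snd c"
      using Cons.IH[OF path] ribbon_path_antitone[OF path(1)] by auto
    then show ?thesis
      using step by (auto simp: ribbon_step_def box_order_def split: if_splits)
  qed
qed simp

lemma ribbon_path_order:
  assumes "successively ribbon_step bs" "successively (box_order m) bs" "b \<in> set bs" "b' \<in> set bs"
  shows "fst b = fst b' \<Longrightarrow> snd b < snd b' \<Longrightarrow> m b \<le> m b'"
    and "snd b = snd b' \<Longrightarrow> fst b < fst b' \<Longrightarrow> m b < m b'"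
proof -
  have "(fst b = fst b' \<and> snd b < snd b' \<longrightarrow> m b \<le> m b') \<and>
    (snd b = snd b' \<and> fst b < fst b' \<longrightarrow> m b < m b')"
    using assms
  proof (induction bs)
    case (Cons c bs)
    have path: "successively ribbon_step bs" "successively (box_order m) bs"
      using Cons.prems by (auto simp: successively_Cons)
    consider "b = c" "b' = c" | "b = c" "b' \<in> set bs" | "b \<in> set bs" "b' = c" | "b \<in> set bs" "b' \<in> set bs"
      using Cons.prems by auto
    then show ?case
    proof cases
      case 2
      then show ?thesis
        using ribbon_path_antitone[OF Cons.prems(1), of b'] ribbon_path_order_head[OF Cons.prems(1,2), of b']
        by auto
    next
      case 3
      then show ?thesis
        using ribbon_path_antitone[OF Cons.prems(1), of b] ribbon_path_order_head[OF Cons.prems(1,2), of b]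
        by auto
    next
      case 4
      then show ?thesis
        using Cons.IH path by blast
    qed auto
  qed simp
  then show "fst b = fst b' \<Longrightarrow> snd b < snd b' \<Longrightarrow> m b \<le> m b'"
    and "snd b = snd b' \<Longrightarrow> fst b < fst b' \<Longrightarrow> m b < m b'"
    by auto
qed

text \<open>This turns the conditions on pairs of boxes into one condition per step of the path.\<close>

lemma semistandard_ribbon_path:
  assumes path: "successively ribbon_step bs"
  shows "semistandard_fillings (set bs) = {m \<in> set bs \<rightarrow>\<^sub>E {1..}. successively (box_order m) bs}"
proof (intro set_eqI iffI)
  fix m assume m: "m \<in> semistandard_fillings (set bs)"
  have "box_order m (bs ! n) (bs ! Suc n)" if "Suc n < length bs" for n
  proof -
    have mem: "bs ! n \<in> set bs" "bs ! Suc n \<in> set bs"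
      using that by auto
    obtain i j i' j' where b: "bs ! n = (i, j)" "bs ! Suc n = (i', j')"
      by fastforce
    have "ribbon_step (i, j) (i', j')"
      using successively_nth[OF path that] b by simp
    then consider "i' = i" "j' < j" | "i' = Suc i" "j' = j"
      by (auto simp: ribbon_step_def)
    then show ?thesis
      using m mem unfolding b by cases (auto simp: semistandard_fillings_def box_order_def)
  qed
  then show "m \<in> {m \<in> set bs \<rightarrow>\<^sub>E {1..}. successively (box_order m) bs}"
    using m by (auto simp: successively_conv_nth semistandard_fillings_def)
next
  fix m assume "m \<in> {m \<in> set bs \<rightarrow>\<^sub>E {1..}. successively (box_order m) bs}"
  then show "m \<in> semistandard_fillings (set bs)"
    using ribbon_path_order[OF path, of m] by (auto simp: semistandard_fillings_def)
qed

section \<open>Minimal expressions have no empty arm after the first hook\<close>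

text \<open>A hook without arm is a column directly below the leg of the previous hook, and lengthens this leg.\<close>

lemma merge_columns:
  fixes p q p' q' :: "nat \<Rightarrow> nat"
  assumes s: "1 \<le> s" "s \<le> r" and ps: "p (Suc s) = 0"
    and p': "p' = (\<lambda>j. if j \<le> s then p j else p (Suc j))"
    and q': "q' = (\<lambda>j. if j < s then q j else if j = s then q s + q (Suc s) else q (Suc j))"
  shows "rib r p' q' = rib (Suc r) p q"
proof -
  define H where "H = (\<lambda>j. arm_height (p j) + q j)"
  define H' where "H' = (\<lambda>j. arm_height (p' j) + q' j)"
  have row_le: "(\<Sum>j\<in>{1..<i}. H' j) = (\<Sum>j\<in>{1..<i}. H j)" if "i \<le> s" for i
    using that by (intro sum.cong) (auto simp: H_def H'_def p' q')
  \<comment> \<open>Beyond the merged hook the indices are shifted by one.\<close>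
  have row_gt: "(\<Sum>j\<in>{1..<Suc s + n}. H' j) = (\<Sum>j\<in>{1..<Suc (Suc s + n)}. H j)" for n
  proof (induction n)
    case 0
    have "(\<Sum>j\<in>{1..<Suc s}. H' j) = (\<Sum>j\<in>{1..<s}. H' j) + H' s"
      using s by simp
    also have "\<dots> = (\<Sum>j\<in>{1..<s}. H j) + H s + H (Suc s)"
      using row_le[of s] by (simp add: H_def H'_def p' q' ps arm_height_def)
    also have "\<dots> = (\<Sum>j\<in>{1..<Suc (Suc s)}. H j)"
      using s by simp
    finally show ?case
      by simp
  next
    case (Suc n)
    have "H' (Suc s + n) = H (Suc (Suc s + n))"
      by (simp add: H_def H'_def p' q')
    then show ?case
      using Suc by simp
  qed
  have col_ge: "(\<Sum>j\<in>{i<..r}. p' j - 1) = (\<Sum>j\<in>{Suc i<..Suc r}. p j - 1)" if "s \<le> i" for i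
  proof -
    have "(\<Sum>j\<in>{i<..r}. p' j - 1) = (\<Sum>j\<in>{i<..r}. p (Suc j) - 1)"
      using that by (intro sum.cong) (auto simp: p')
    also have "\<dots> = (\<Sum>j\<in>{Suc i<..Suc r}. p j - 1)"
      by (rule sum.reindex_bij_witness[of _ "\<lambda>j. j - 1" Suc]) auto
    finally show ?thesis .
  qed
  have col_le: "(\<Sum>j\<in>{i<..r}. p' j - 1) = (\<Sum>j\<in>{i<..Suc r}. p j - 1)" if "i \<le> s" for i
  proof -
    have 1: "{i<..r} = {i<..s} \<union> {s<..r}" "{i<..Suc r} = {i<..s} \<union> insert (Suc s) {Suc s<..Suc r}"
      using that s by auto
    have "(\<Sum>j\<in>{i<..r}. p' j - 1) = (\<Sum>j\<in>{i<..s}. p' j - 1) + (\<Sum>j\<in>{s<..r}. p' j - 1)"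
      unfolding 1 by (rule sum.union_disjoint) auto
    also have "\<dots> = (\<Sum>j\<in>{i<..s}. p j - 1) + (\<Sum>j\<in>insert (Suc s) {Suc s<..Suc r}. p j - 1)"
    proof (rule arg_cong2[of _ _ _ _ "(+)"])
      show "(\<Sum>j\<in>{i<..s}. p' j - 1) = (\<Sum>j\<in>{i<..s}. p j - 1)"
        by (intro sum.cong) (auto simp: p')
      show "(\<Sum>j\<in>{s<..r}. p' j - 1) = (\<Sum>j\<in>insert (Suc s) {Suc s<..Suc r}. p j - 1)"
        using col_ge[of s] ps by simp
    qed
    also have "\<dots> = (\<Sum>j\<in>{i<..Suc r}. p j - 1)"
      unfolding 1 by (rule sum.union_disjoint[symmetric]) auto
    finally show ?thesis .
  qed
  let ?P = "\<lambda>j. rib_position (Suc r) p q j ` hook (p j) (q j)"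
  let ?P' = "\<lambda>j. rib_position r p' q' j ` hook (p' j) (q' j)"
  have lt: "?P' j = ?P j" if "j < s" for j
  proof -
    have "rib_position r p' q' j = rib_position (Suc r) p q j"
      unfolding rib_position_def using row_le[of j] col_le[of j] that by (simp add: H_def H'_def)
    then show ?thesis
      using that by (simp add: p' q')
  qed
  have gt: "?P' j = ?P (Suc j)" if "s < j" for j
  proof -
    have "rib_position r p' q' j = rib_position (Suc r) p q (Suc j)"
      unfolding rib_position_def using row_gt[of "j - Suc s"] col_ge[of j] that by (simp add: H_def H'_def)
    then show ?thesis
      using that by (simp add: p' q')
  qed
  have eq: "?P' s = ?P s \<union> ?P (Suc s)"
  proof -
    define R where "R = (\<Sum>j\<in>{1..<s}. H j)"
    define C where "C = (\<Sum>j\<in>{s<..Suc r}. p j - 1)"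
    have pos': "rib_position r p' q' s = (\<lambda>(a, b). (a + R, b + C))"
      unfolding rib_position_def R_def C_def using row_le[of s] col_le[of s] by (simp add: H_def H'_def)
    have pos: "rib_position (Suc r) p q s = (\<lambda>(a, b). (a + R, b + C))"
      unfolding rib_position_def R_def C_def by (simp add: H_def)
    have "{s<..Suc r} = insert (Suc s) {Suc s<..Suc r}"
      using s by auto
    then have "C = (\<Sum>j\<in>{Suc s<..Suc r}. p j - 1)"
      by (simp add: C_def ps)
    moreover have "(\<Sum>j\<in>{1..<Suc s}. H j) = R + H s"
      using s by (simp add: R_def)
    ultimately have pos_Suc: "rib_position (Suc r) p q (Suc s) = (\<lambda>(a, b). (a + (R + H s), b + C))"
      unfolding rib_position_def by (simp add: H_def)
    have hook': "hook (p' s) (q' s) = hook (p s) (q s) \<union> {(H s + l, 1) |l. l \<in> {1..q (Suc s)}}"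
    proof -
      have "{1..q s + q (Suc s)} = {1..q s} \<union> (\<lambda>l. q s + l) ` {1..q (Suc s)}"
      proof -
        have "x = q s + (x - q s) \<and> x - q s \<in> {1..q (Suc s)}"
          if "x \<le> q s + q (Suc s)" "\<not> x \<le> q s" for x
          using that by auto
        then show ?thesis
          by force
      qed
      moreover have "p' s = p s" "q' s = q s + q (Suc s)"
        by (simp_all add: p' q')
      ultimately show ?thesis
        unfolding hook_def H_def Setcompr_eq_image
        by (simp only: image_Un image_image add.assoc Un_assoc)
    qed
    have hook_Suc: "hook (p (Suc s)) (q (Suc s)) = {(l, 1) |l. l \<in> {1..q (Suc s)}}"
      unfolding hook_def ps by (auto simp: arm_height_def)
    show ?thesis
      unfolding pos pos' pos_Suc hook' hook_Suc Setcompr_eq_image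
      by (simp add: image_Un image_image add_ac)
  qed
  have "rib r p' q' = (\<Union>j\<in>{1..<s}. ?P' j) \<union> ?P' s \<union> (\<Union>j\<in>{s<..r}. ?P' j)"
  proof -
    have "{1..r} = {1..<s} \<union> {s} \<union> {s<..r}"
      using s by auto
    then show ?thesis
      unfolding rib_def by auto
  qed
  also have "\<dots> = (\<Union>j\<in>{1..<s}. ?P j) \<union> (?P s \<union> ?P (Suc s)) \<union> (\<Union>j\<in>{s<..r}. ?P (Suc j))"
    using lt gt eq by auto
  also have "\<dots> = rib (Suc r) p q"
  proof -
    have "{1..Suc r} = {1..<s} \<union> {s, Suc s} \<union> Suc ` {s<..r}"
    proof -
      have "Suc ` {s<..r} = {Suc s<..Suc r}"
        unfolding atLeastSucAtMost_greaterThanAtMost[symmetric] by (rule image_Suc_atLeastAtMost)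
      then show ?thesis
        using s by auto
    qed
    then show ?thesis
      unfolding rib_def by (simp add: Un_ac)
  qed
  finally show ?thesis .
qed

lemma minimal_expression_arm_pos:
  assumes "minimal_expression r p q" "2 \<le> i" "i \<le> r"
  shows "1 \<le> p i"
proof (rule ccontr)
  assume "\<not> 1 \<le> p i"
  then have pi: "p (Suc (i - 1)) = 0"
    using assms by simp
  have r: "r = Suc (r - 1)"
    using assms by simp
  have minimal: "r \<le> r'" if "1 \<le> r'" "rib r' p' q' = rib r p q" for r' p' q'
    using assms(1) that unfolding minimal_expression_def by blast
  have "1 \<le> i - 1" "i - 1 \<le> r - 1" "1 \<le> r - 1"
    using assms by auto
  note merged = merge_columns[where s = "i - 1" and r = "r - 1" and p = p and q = q,
      OF this(1,2) pi refl refl]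
  have "r \<le> r - 1"
    by (rule minimal[OF \<open>1 \<le> r - 1\<close> merged[unfolded r[symmetric]]])
  then show False
    using assms by simp
qed

section \<open>Lists built hook by hook\<close>

lemma successively_map_upt:
  "successively P (map f [a..<b]) \<longleftrightarrow> (\<forall>j. a \<le> j \<and> Suc j < b \<longrightarrow> P (f j) (f (Suc j)))"
proof
  assume *: "successively P (map f [a..<b])"
  show "\<forall>j. a \<le> j \<and> Suc j < b \<longrightarrow> P (f j) (f (Suc j))"
  proof (intro allI impI)
    fix j assume "a \<le> j \<and> Suc j < b"
    then show "P (f j) (f (Suc j))"
      using successively_nth[OF *, of "j - a"] by (auto simp: Suc_diff_le)
  qed
qed (auto simp: successively_conv_nth)

text \<open>Only the first of the lists may be empty; otherwise neighbours in the concatenation could come from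
lists that are not adjacent.\<close>

lemma successively_concat_upt:
  assumes "\<And>i. 2 \<le> i \<Longrightarrow> i \<le> r \<Longrightarrow> f i \<noteq> []"
  shows "successively P (concat (map f [1..<Suc r])) \<longleftrightarrow> (\<forall>i\<in>{1..r}. successively P (f i)) \<and>
    (\<forall>i\<in>{1..<r}. f i \<noteq> [] \<longrightarrow> P (last (f i)) (hd (f (Suc i))))"
  using assms
proof (induction r)
  case (Suc r)
  show ?case
  proof (cases "r = 0")
    case False
    have last: "last (concat (map f [1..<Suc r])) = last (f r)" if "f r \<noteq> []"
      using False that by simp
    have ne: "concat (map f [1..<Suc r]) \<noteq> [] \<longleftrightarrow> f r \<noteq> []"
    proof (cases "r = 1")
      case False
      then show ?thesis
        using Suc.prems[of r] \<open>r \<noteq> 0\<close> by auto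
    qed simp
    have app: "concat (map f [1..<Suc (Suc r)]) = concat (map f [1..<Suc r]) @ f (Suc r)"
      by simp
    have "successively P (concat (map f [1..<Suc (Suc r)])) \<longleftrightarrow>
      successively P (concat (map f [1..<Suc r])) \<and> successively P (f (Suc r)) \<and>
      (f r \<noteq> [] \<longrightarrow> P (last (f r)) (hd (f (Suc r))))"
      unfolding app successively_append_iff using False ne last Suc.prems[of "Suc r"] by auto
    also have "\<dots> \<longleftrightarrow> (\<forall>i\<in>{1..Suc r}. successively P (f i)) \<and>
      (\<forall>i\<in>{1..<Suc r}. f i \<noteq> [] \<longrightarrow> P (last (f i)) (hd (f (Suc i))))"
    proof -
      have "{1..Suc r} = insert (Suc r) {1..r}" "{1..<Suc r} = insert r {1..<r}"
        using False by auto
      then show ?thesis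
        using Suc.IH Suc.prems by auto
    qed
    finally show ?thesis .
  qed auto
qed simp

lemma concat_map_upt_blocks:
  fixes a :: "nat \<Rightarrow> nat"
  assumes "\<And>k. k \<in> {1..n} \<Longrightarrow> a (k - 1) \<le> a k"
  shows "concat (map (\<lambda>k. map f [Suc (a (k - 1))..<Suc (a k)]) [1..<Suc n]) = map f [Suc (a 0)..<Suc (a n)]"
  using assms
proof (induction n)
  case (Suc n)
  have "a 0 \<le> a n"
  proof -
    have "k \<le> n \<Longrightarrow> a 0 \<le> a k" for k
    proof (induction k)
      case (Suc k)
      then show ?case
        using Suc.prems \<open>\<And>k. k \<in> {1..Suc n} \<Longrightarrow> a (k - 1) \<le> a k\<close>[of "Suc k"] by auto
    qed simp
    then show ?thesis
      by simp
  qed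
  moreover have "a n \<le> a (Suc n)"
    using Suc.prems[of "Suc n"] by simp
  ultimately have "[Suc (a 0)..<Suc (a (Suc n))] = [Suc (a 0)..<Suc (a n)] @ [Suc (a n)..<Suc (a (Suc n))]"
    using upt_add_eq_append[of "Suc (a 0)" "Suc (a n)" "a (Suc n) - a n"] by simp
  moreover have "[1..<Suc (Suc n)] = [1..<Suc n] @ [Suc n]"
    by simp
  ultimately show ?case
    using Suc by (simp del: upt_Suc)
qed simp

lemma distinct_concat_upt:
  assumes "\<And>i. i \<in> {1..r} \<Longrightarrow> distinct (f i)"
    and "\<And>i j. i \<in> {1..r} \<Longrightarrow> j \<in> {1..r} \<Longrightarrow> i \<noteq> j \<Longrightarrow> set (f i) \<inter> set (f j) = {}"
  shows "distinct (concat (map f [1..<Suc r]))"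
  using assms
proof (induction r)
  case (Suc r)
  have "[1..<Suc (Suc r)] = [1..<Suc r] @ [Suc r]"
    by simp
  moreover have "distinct (concat (map f [1..<Suc r]))"
    by (rule Suc.IH) (use Suc.prems in auto)
  moreover have "x \<notin> set (f (Suc r))" if "x \<in> set (concat (map f [1..<Suc r]))" for x
    using that Suc.prems(2)[of _ "Suc r"] by (force simp del: upt_Suc)
  ultimately show ?case
    using Suc.prems(1)[of "Suc r"] by (auto simp del: upt_Suc)
qed simp

lemma concat_concat: "concat (concat xsss) = concat (map concat xsss)"
  by (induction xsss) auto

lemma prod_list_concat: "prod_list (concat xss) = prod_list (map prod_list xss)"
  by (induction xss) auto

lemma prod_list_map_upt:
  fixes f :: "nat \<Rightarrow> 'a::comm_monoid_mult"
  shows "prod_list (map f [a..<b]) = (\<Prod>i\<in>{a..<b}. f i)"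
  by (simp add: prod.distinct_set_conv_list[symmetric])

lemma successively_cong_pairs:
  assumes "successively (\<lambda>u w. P u w = Q u w) xs"
  shows "successively P xs = successively Q xs"
  using assms by (induction xs) (auto simp: successively_Cons)

lemma prod_list_ennreal:
  assumes "\<And>x. x \<in> set xs \<Longrightarrow> 0 \<le> g x"
  shows "prod_list (map (\<lambda>x. ennreal (g x)) xs) = ennreal (prod_list (map g xs))"
  using assms
proof (induction xs)
  case (Cons x xs)
  then have "0 \<le> prod_list (map g xs)"
    by (intro prod_list_nonneg) auto
  with Cons show ?case
    by (simp add: ennreal_mult)
qed simp

section \<open>The boxes and the variables of a ribbon as lists\<close>

text \<open>The case \<open>r = 1\<close> with an empty hook is included; then there are no boxes and no variables.\<close>

locale ribbon_integral =
  fixes r :: nat and p q :: "nat \<Rightarrow> nat" and \<alpha> \<beta> :: "nat \<Rightarrow> nat \<Rightarrow> nat"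
  assumes arm_pos: "\<And>i. 2 \<le> i \<Longrightarrow> i \<le> r \<Longrightarrow> 1 \<le> p i"
    and \<alpha>_pos: "\<And>i k. i \<in> {1..r} \<Longrightarrow> k \<in> {1..p i} \<Longrightarrow> 1 \<le> \<alpha> i k"
    and \<alpha>_last: "\<And>i. i \<in> {1..r} \<Longrightarrow> 1 \<le> p i \<Longrightarrow> 2 \<le> \<alpha> i (p i)"
    and \<beta>_pos: "\<And>i l. i \<in> {1..r} \<Longrightarrow> l \<in> {1..q i} \<Longrightarrow> 1 \<le> \<beta> i l"
    and \<beta>_last: "1 \<le> q r \<Longrightarrow> 2 \<le> \<beta> r (q r)"
    and r_pos: "1 \<le> r"
begin

abbreviation "A \<equiv> A_sum p \<alpha>"
abbreviation "B \<equiv> B_sum \<beta>"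

text \<open>The names of the integration variables also serve as names of boxes: \<open>Xvar i k\<close> names the \<open>k\<close>-th
box from the right in the row of the \<open>i\<close>-th hook, the one with the variables of $\alpha^{(i)}_{p_i+1-k}$,
and \<open>Yvar i l\<close> the \<open>l\<close>-th box of its leg.\<close>

definition hook_blocks :: "nat \<Rightarrow> ivar list" where
  "hook_blocks i = map (Xvar i) [1..<Suc (p i)] @ map (Yvar i) [1..<Suc (q i)]"

definition blocks :: "ivar list" where
  "blocks = concat (map hook_blocks [1..<Suc r])"

fun block_box :: "ivar \<Rightarrow> box" where
  "block_box (Xvar i k) = rib_position r p q i (1, p i + 1 - k)"
| "block_box (Yvar i l) = rib_position r p q i (arm_height (p i) + l, 1)"

fun block_exponent :: "ivar \<Rightarrow> nat" where
  "block_exponent (Xvar i k) = \<alpha> i (p i + 1 - k)"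
| "block_exponent (Yvar i l) = \<beta> i l"

fun goes_left :: "ivar \<Rightarrow> bool" where
  "goes_left (Xvar i k) = (2 \<le> k)"
| "goes_left (Yvar i l) = False"

fun block_vars :: "ivar \<Rightarrow> ivar list" where
  "block_vars (Xvar i k) = map (Xvar i) [Suc (A i (k - 1))..<Suc (A i k)]"
| "block_vars (Yvar i l) = map (Yvar i) [Suc (B i (l - 1))..<Suc (B i l)]"

definition hook_vars :: "nat \<Rightarrow> ivar list" where
  "hook_vars i = map (Xvar i) [1..<Suc (A i (p i))] @ map (Yvar i) [1..<Suc (B i (q i))]"

definition vars :: "ivar list" where
  "vars = concat (map hook_vars [1..<Suc r])"

fun starts_block :: "ivar \<Rightarrow> bool" where
  "starts_block (Xvar i j) = (\<exists>k<p i. j = Suc (A i k))"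
| "starts_block (Yvar i j) = (\<exists>l<q i. j = Suc (B i l))"

fun goes_up :: "ivar \<Rightarrow> bool" where
  "goes_up (Xvar i j) = (\<exists>k\<in>{1..<p i}. j = Suc (A i k))"
| "goes_up (Yvar i j) = False"

definition var_kernel :: "ivar \<Rightarrow> real \<Rightarrow> real \<Rightarrow> ennreal" where
  "var_kernel u = step_kernel (goes_up u) (if starts_block u then form1 else form0)"

lemma A_0 [simp]: "A i 0 = 0"
  by (simp add: A_sum_def)

lemma B_0 [simp]: "B i 0 = 0"
  by (simp add: B_sum_def)

lemma A_step: "1 \<le> k \<Longrightarrow> k \<le> p i \<Longrightarrow> A i k = A i (k - 1) + \<alpha> i (p i + 1 - k)"
proof -
  assume k: "1 \<le> k" "k \<le> p i"
  then have "{p i + 1 - k..p i} = insert (p i + 1 - k) {p i + 1 - (k - 1)..p i}"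
    by auto
  then show ?thesis
    using k by (simp add: A_sum_def)
qed

lemma B_step: "1 \<le> l \<Longrightarrow> B i l = B i (l - 1) + \<beta> i l"
  by (cases l) (auto simp: B_sum_def)

lemma A_step_less: "i \<in> {1..r} \<Longrightarrow> 1 \<le> k \<Longrightarrow> k \<le> p i \<Longrightarrow> A i (k - 1) < A i k"
  using A_step[of k i] \<alpha>_pos[of i "p i + 1 - k"] by (auto simp: Suc_le_eq)

lemma B_step_less: "i \<in> {1..r} \<Longrightarrow> 1 \<le> l \<Longrightarrow> l \<le> q i \<Longrightarrow> B i (l - 1) < B i l"
  using B_step[of l i] \<beta>_pos[of i l] by auto

lemma A_less: "i \<in> {1..r} \<Longrightarrow> j < k \<Longrightarrow> k \<le> p i \<Longrightarrow> A i j < A i k"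
proof (induction k)
  case (Suc k)
  then show ?case
    using A_step_less[of i "Suc k"] by (cases "j = k") auto
qed simp

lemma B_less: "i \<in> {1..r} \<Longrightarrow> j < l \<Longrightarrow> l \<le> q i \<Longrightarrow> B i j < B i l"
proof (induction l)
  case (Suc l)
  then show ?case
    using B_step_less[of i "Suc l"] by (cases "j = l") auto
qed simp

lemma A_eq_iff: "i \<in> {1..r} \<Longrightarrow> j \<le> p i \<Longrightarrow> k \<le> p i \<Longrightarrow> A i j = A i k \<longleftrightarrow> j = k"
  using A_less[of i j k] A_less[of i k j] by (cases j k rule: linorder_cases) auto

lemma A_less_imp: "i \<in> {1..r} \<Longrightarrow> j \<le> p i \<Longrightarrow> A i j < A i k \<Longrightarrow> j < k"
  using A_less[of i k j] by (cases j k rule: linorder_cases) auto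

lemma B_less_imp: "i \<in> {1..r} \<Longrightarrow> j \<le> q i \<Longrightarrow> B i j < B i k \<Longrightarrow> j < k"
  using B_less[of i k j] by (cases j k rule: linorder_cases) auto

lemma set_blocks:
  "set blocks = {Xvar i k |i k. i \<in> {1..r} \<and> k \<in> {1..p i}} \<union> {Yvar i l |i l. i \<in> {1..r} \<and> l \<in> {1..q i}}"
  unfolding blocks_def hook_blocks_def
  by (simp only: set_concat set_map image_image set_append set_upt atLeastLessThanSuc_atLeastAtMost) blast

lemma set_vars: "set vars = ivars r p q \<alpha> \<beta>"
  unfolding vars_def hook_vars_def ivars_def
  by (simp only: set_concat set_map image_image set_append set_upt atLeastLessThanSuc_atLeastAtMost) blast

lemma distinct_vars: "distinct vars"
  unfolding vars_def
proof (rule distinct_concat_upt)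
  show "distinct (hook_vars i)" for i
    by (auto simp: hook_vars_def distinct_map inj_on_def simp del: upt_Suc)
  show "set (hook_vars i) \<inter> set (hook_vars j) = {}" if "i \<noteq> j" for i j
    using that by (auto simp: hook_vars_def simp del: upt_Suc)
qed

lemma concat_block_vars: "concat (map block_vars blocks) = vars"
proof -
  have 1: "concat (map block_vars (hook_blocks i)) = hook_vars i" if "i \<in> {1..r}" for i
  proof -
    have "concat (map (\<lambda>k. map (Xvar i) [Suc (A i (k - 1))..<Suc (A i k)]) [1..<Suc (p i)]) =
      map (Xvar i) [Suc (A i 0)..<Suc (A i (p i))]"
      by (rule concat_map_upt_blocks) (use A_step_less[OF that] in \<open>auto intro: less_imp_le\<close>)
    moreover have "concat (map (\<lambda>l. map (Yvar i) [Suc (B i (l - 1))..<Suc (B i l)]) [1..<Suc (q i)]) =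
      map (Yvar i) [Suc (B i 0)..<Suc (B i (q i))]"
      by (rule concat_map_upt_blocks) (use B_step_less[OF that] in \<open>auto intro: less_imp_le\<close>)
    ultimately show ?thesis
      unfolding hook_blocks_def hook_vars_def by (simp add: comp_def del: upt_Suc)
  qed
  have "concat (map block_vars blocks) = concat (map (\<lambda>i. concat (map block_vars (hook_blocks i))) [1..<Suc r])"
    unfolding blocks_def by (simp add: map_concat concat_concat comp_def del: upt_Suc)
  also have "\<dots> = vars"
    unfolding vars_def by (intro arg_cong[where f = concat] map_cong) (use 1 in auto)
  finally show ?thesis .
qed

lemma block_exponent_pos: "v \<in> set blocks \<Longrightarrow> 1 \<le> block_exponent v"
proof -
  assume "v \<in> set blocks"
  then consider i k where "v = Xvar i k" "i \<in> {1..r}" "k \<in> {1..p i}"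
    | i l where "v = Yvar i l" "i \<in> {1..r}" "l \<in> {1..q i}"
    by (auto simp: set_blocks)
  then show ?thesis
  proof cases
    case 1
    then show ?thesis
      using \<alpha>_pos[of i "p i + 1 - k"] by (auto simp: Suc_le_eq)
  next
    case 2
    then show ?thesis
      using \<beta>_pos[of i l] by auto
  qed
qed

lemma length_block_vars: "v \<in> set blocks \<Longrightarrow> length (block_vars v) = block_exponent v"
  using A_step B_step by (auto simp: set_blocks simp del: upt_Suc)

lemma block_vars_not_Nil: "v \<in> set blocks \<Longrightarrow> block_vars v \<noteq> []"
  using length_block_vars[of v] block_exponent_pos[of v] by auto

text \<open>The first variable of a block comes after a partial sum $A^{(i)}_{k-1}$. It is reached by a decrease
exactly if \<open>k - 1 \<ge> 1\<close>, that is, if the box has a right neighbour in its hook.\<close>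

lemma var_kernel_hd:
  assumes "v \<in> set blocks"
  shows "starts_block (hd (block_vars v))" and "goes_up (hd (block_vars v)) = goes_left v"
proof -
  have "starts_block (hd (block_vars v)) \<and> goes_up (hd (block_vars v)) = goes_left v"
  proof (cases v)
    case (Xvar i k)
    then have ik: "i \<in> {1..r}" "1 \<le> k" "k \<le> p i"
      using assms by (auto simp: set_blocks)
    have hd: "hd (block_vars v) = Xvar i (Suc (A i (k - 1)))"
      using A_step_less[OF ik] by (simp add: Xvar upt_conv_Cons hd_map del: upt_Suc)
    have "(\<exists>k'\<in>{1..<p i}. A i (k - 1) = A i k') \<longleftrightarrow> 2 \<le> k"
      using ik by (auto simp: A_eq_iff intro!: bexI[of _ "k - 1"])
    moreover have "k - 1 < p i"
      using ik by auto
    ultimately show ?thesis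
      unfolding hd using Xvar by auto
  next
    case (Yvar i l)
    then have il: "i \<in> {1..r}" "1 \<le> l" "l \<le> q i"
      using assms by (auto simp: set_blocks)
    have hd: "hd (block_vars v) = Yvar i (Suc (B i (l - 1)))"
      using B_step_less[OF il] by (simp add: Yvar upt_conv_Cons hd_map del: upt_Suc)
    have "l - 1 < q i"
      using il by auto
    then show ?thesis
      unfolding hd using Yvar by auto
  qed
  then show "starts_block (hd (block_vars v))" and "goes_up (hd (block_vars v)) = goes_left v"
    by auto
qed

lemma goes_up_imp_starts_block: "goes_up u \<Longrightarrow> starts_block u"
  by (cases u) auto

text \<open>The partial sums are strictly increasing, so that none of them lies strictly inside a block.\<close>

lemma not_starts_block_tl:
  assumes "v \<in> set blocks" "u \<in> set (tl (block_vars v))"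
  shows "\<not> starts_block u"
proof (cases v)
  case (Xvar i k)
  then have ik: "i \<in> {1..r}" "1 \<le> k" "k \<le> p i"
    using assms by (auto simp: set_blocks)
  have tl: "tl (block_vars v) = map (Xvar i) [Suc (Suc (A i (k - 1)))..<Suc (A i k)]"
    using A_step_less[OF ik] by (simp add: Xvar upt_conv_Cons map_tl del: upt_Suc)
  from assms(2) have "u \<in> Xvar i ` {Suc (Suc (A i (k - 1)))..<Suc (A i k)}"
    unfolding tl set_map set_upt .
  then obtain j where j: "u = Xvar i j" "j \<in> {Suc (Suc (A i (k - 1)))..<Suc (A i k)}"
    by (rule imageE)
  from j(2) have u: "u = Xvar i j" "Suc (A i (k - 1)) < j" "j \<le> A i k"
    by (simp_all add: j(1))
  have False if "k' < p i" "j = Suc (A i k')" for k'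
  proof -
    have "k - 1 < k'" "k' < k"
      by (rule A_less_imp[of i]; use that u ik in simp)+
    then show False
      by simp
  qed
  then show ?thesis
    using u by auto
next
  case (Yvar i l)
  then have il: "i \<in> {1..r}" "1 \<le> l" "l \<le> q i"
    using assms by (auto simp: set_blocks)
  have tl: "tl (block_vars v) = map (Yvar i) [Suc (Suc (B i (l - 1)))..<Suc (B i l)]"
    using B_step_less[OF il] by (simp add: Yvar upt_conv_Cons map_tl del: upt_Suc)
  from assms(2) have "u \<in> Yvar i ` {Suc (Suc (B i (l - 1)))..<Suc (B i l)}"
    unfolding tl set_map set_upt .
  then obtain j where j: "u = Yvar i j" "j \<in> {Suc (Suc (B i (l - 1)))..<Suc (B i l)}"
    by (rule imageE)
  from j(2) have u: "u = Yvar i j" "Suc (B i (l - 1)) < j" "j \<le> B i l"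
    by (simp_all add: j(1))
  have False if "l' < q i" "j = Suc (B i l')" for l'
  proof -
    have "l - 1 < l'" "l' < l"
      by (rule B_less_imp[of i]; use that u il in simp)+
    then show False
      by simp
  qed
  then show ?thesis
    using u by auto
qed

section \<open>The domain and the integrand along the list of variables\<close>

lemma hook_vars_eq_Nil_iff:
  assumes "i \<in> {1..r}"
  shows "hook_vars i = [] \<longleftrightarrow> p i = 0 \<and> q i = 0"
  using A_less[OF assms, of 0 "p i"] B_less[OF assms, of 0 "q i"]
  by (cases "p i = 0"; cases "q i = 0") (auto simp: hook_vars_def simp del: upt_Suc)

definition var_order :: "(ivar \<Rightarrow> real) \<Rightarrow> ivar \<Rightarrow> ivar \<Rightarrow> bool" where
  "var_order z u w \<longleftrightarrow> (if goes_up w then z w < z u else z u < z w)"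

lemma not_goes_up_1: "i \<in> {1..r} \<Longrightarrow> \<not> goes_up (Xvar i (Suc 0))"
  using A_less[of i 0] by auto

lemma successively_hook_vars:
  assumes i: "i \<in> {1..r}"
  shows "successively (var_order z) (hook_vars i) \<longleftrightarrow>
    (\<forall>j. 1 \<le> j \<and> j < A i (p i) \<longrightarrow>
        (if j \<in> A i ` {1..<p i} then z (Xvar i j) > z (Xvar i (j + 1))
         else z (Xvar i j) < z (Xvar i (j + 1)))) \<and>
    (\<forall>j. 1 \<le> j \<and> j < B i (q i) \<longrightarrow> z (Yvar i j) < z (Yvar i (j + 1))) \<and>
    (p i \<noteq> 0 \<and> q i \<noteq> 0 \<longrightarrow> z (Xvar i (A i (p i))) < z (Yvar i 1))"
proof -
  have x: "var_order z (Xvar i j) (Xvar i (Suc j)) \<longleftrightarrow>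
    (if j \<in> A i ` {1..<p i} then z (Xvar i j) > z (Xvar i (j + 1)) else z (Xvar i j) < z (Xvar i (j + 1)))" for j
    by (auto simp: var_order_def)
  have y: "var_order z (Yvar i j) (Yvar i (Suc j)) \<longleftrightarrow> z (Yvar i j) < z (Yvar i (j + 1))" for j
    by (simp add: var_order_def)
  have "var_order z (last (map (Xvar i) [1..<Suc (A i (p i))])) (hd (map (Yvar i) [1..<Suc (B i (q i))])) \<longleftrightarrow>
    z (Xvar i (A i (p i))) < z (Yvar i 1)" if "p i \<noteq> 0" "q i \<noteq> 0"
    using that A_less[OF i, of 0 "p i"] B_less[OF i, of 0 "q i"]
    by (simp add: last_map hd_map var_order_def del: upt_Suc)
  moreover have "map (Xvar i) [1..<Suc (A i (p i))] = [] \<longleftrightarrow> p i = 0"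
    using A_less[OF i, of 0 "p i"] by (cases "p i = 0") (auto simp del: upt_Suc)
  moreover have "map (Yvar i) [1..<Suc (B i (q i))] = [] \<longleftrightarrow> q i = 0"
    using B_less[OF i, of 0 "q i"] by (cases "q i = 0") (auto simp del: upt_Suc)
  ultimately have "successively (var_order z) (hook_vars i) \<longleftrightarrow>
    (\<forall>j. 1 \<le> j \<and> Suc j < Suc (A i (p i)) \<longrightarrow> var_order z (Xvar i j) (Xvar i (Suc j))) \<and>
    (\<forall>j. 1 \<le> j \<and> Suc j < Suc (B i (q i)) \<longrightarrow> var_order z (Yvar i j) (Yvar i (Suc j))) \<and>
    (p i \<noteq> 0 \<and> q i \<noteq> 0 \<longrightarrow> z (Xvar i (A i (p i))) < z (Yvar i 1))"
    unfolding hook_vars_def successively_append_iff successively_map_upt by argo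
  then show ?thesis
    unfolding x y Suc_less_eq .
qed

lemma var_order_next_hook:
  assumes i: "i \<in> {1..<r}" "hook_vars i \<noteq> []"
  shows "var_order z (last (hook_vars i)) (hd (hook_vars (Suc i))) \<longleftrightarrow>
    (if q i = 0 then z (Xvar i (A i (p i))) < z (Xvar (i + 1) 1)
     else z (Yvar i (B i (q i))) < z (Xvar (i + 1) 1))"
proof -
  have "1 \<le> p (Suc i)"
    using arm_pos[of "Suc i"] i by auto
  then have "0 < A (Suc i) (p (Suc i))"
    using A_less[of "Suc i" 0 "p (Suc i)"] i by auto
  then have hd: "hd (hook_vars (Suc i)) = Xvar (Suc i) 1"
    by (simp add: hook_vars_def upt_conv_Cons del: upt_Suc)
  have last: "last (hook_vars i) = (if q i = 0 then Xvar i (A i (p i)) else Yvar i (B i (q i)))"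
    using i hook_vars_eq_Nil_iff[of i] A_less[of i 0 "p i"] B_less[of i 0 "q i"]
    by (auto simp: hook_vars_def last_append last_map simp del: upt_Suc)
  show ?thesis
    unfolding hd last using not_goes_up_1[of "Suc i"] i by (auto simp: var_order_def)
qed

text \<open>The conditions (a) to (d) describe the consecutive pairs inside a row, inside a leg, from
row to leg, and from one hook to the next.\<close>

lemma \<Delta>_eq: "\<Delta> r p q \<alpha> \<beta> = {z \<in> ivars r p q \<alpha> \<beta> \<rightarrow>\<^sub>E {0..1}. successively (var_order z) vars}"
proof -
  have pS: "p (i + 1) \<noteq> 0" if "i \<in> {1..<r}" for i
    using arm_pos[of "Suc i"] that by auto
  have eq: "successively (var_order z) vars \<longleftrightarrow>
     (\<forall>i\<in>{1..r}. \<forall>j. 1 \<le> j \<and> j < A_sum p \<alpha> i (p i) \<longrightarrow>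
        (if j \<in> A_sum p \<alpha> i ` {1..<p i} then z (Xvar i j) > z (Xvar i (j + 1))
         else z (Xvar i j) < z (Xvar i (j + 1)))) \<and>
     (\<forall>i\<in>{1..r}. \<forall>j. 1 \<le> j \<and> j < B_sum \<beta> i (q i) \<longrightarrow> z (Yvar i j) < z (Yvar i (j + 1))) \<and>
     (\<forall>i\<in>{1..r}. p i \<noteq> 0 \<longrightarrow>
        (q i \<noteq> 0 \<longrightarrow> z (Xvar i (A_sum p \<alpha> i (p i))) < z (Yvar i 1)) \<and>
        (q i = 0 \<and> i < r \<and> p (i + 1) \<noteq> 0 \<longrightarrow> z (Xvar i (A_sum p \<alpha> i (p i))) < z (Xvar (i + 1) 1))) \<and>
     (\<forall>i\<in>{1..<r}. q i \<noteq> 0 \<and> p (i + 1) \<noteq> 0 \<longrightarrow>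
        z (Yvar i (B_sum \<beta> i (q i))) < z (Xvar (i + 1) 1))"
    (is "_ \<longleftrightarrow> (\<forall>i\<in>_. ?X i) \<and> (\<forall>i\<in>_. ?Y i) \<and> (\<forall>i\<in>_. _ \<longrightarrow> (_ \<longrightarrow> ?XY i) \<and> (_ \<longrightarrow> ?XX i)) \<and> (\<forall>i\<in>_. _ \<longrightarrow> ?YX i)")
    for z
  proof -
    have "successively (var_order z) vars \<longleftrightarrow> (\<forall>i\<in>{1..r}. successively (var_order z) (hook_vars i)) \<and>
      (\<forall>i\<in>{1..<r}. hook_vars i \<noteq> [] \<longrightarrow> var_order z (last (hook_vars i)) (hd (hook_vars (Suc i))))"
      unfolding vars_def
    proof (rule successively_concat_upt)
      show "hook_vars i \<noteq> []" if "2 \<le> i" "i \<le> r" for i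
        using that arm_pos[OF that] by (simp add: hook_vars_eq_Nil_iff)
    qed
    also have "(\<forall>i\<in>{1..r}. successively (var_order z) (hook_vars i)) \<longleftrightarrow>
      (\<forall>i\<in>{1..r}. ?X i \<and> ?Y i \<and> (p i \<noteq> 0 \<and> q i \<noteq> 0 \<longrightarrow> ?XY i))"
      by (intro ball_cong refl successively_hook_vars)
    also have "(\<forall>i\<in>{1..<r}. hook_vars i \<noteq> [] \<longrightarrow> var_order z (last (hook_vars i)) (hd (hook_vars (Suc i)))) \<longleftrightarrow>
      (\<forall>i\<in>{1..<r}. (p i \<noteq> 0 \<and> q i = 0 \<longrightarrow> ?XX i) \<and> (q i \<noteq> 0 \<longrightarrow> ?YX i))"
    proof (intro ball_cong refl)
      fix i assume i: "i \<in> {1..<r}"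
      then have "hook_vars i \<noteq> [] \<longleftrightarrow> \<not> (p i = 0 \<and> q i = 0)"
        using hook_vars_eq_Nil_iff[of i] by auto
      then show "(hook_vars i \<noteq> [] \<longrightarrow> var_order z (last (hook_vars i)) (hd (hook_vars (Suc i)))) \<longleftrightarrow>
        (p i \<noteq> 0 \<and> q i = 0 \<longrightarrow> ?XX i) \<and> (q i \<noteq> 0 \<longrightarrow> ?YX i)"
        using var_order_next_hook[OF i, of z] by argo
    qed
    also have "((\<forall>i\<in>{1..r}. ?X i \<and> ?Y i \<and> (p i \<noteq> 0 \<and> q i \<noteq> 0 \<longrightarrow> ?XY i)) \<and>
      (\<forall>i\<in>{1..<r}. (p i \<noteq> 0 \<and> q i = 0 \<longrightarrow> ?XX i) \<and> (q i \<noteq> 0 \<longrightarrow> ?YX i))) \<longleftrightarrow>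
      ((\<forall>i\<in>{1..r}. ?X i) \<and> (\<forall>i\<in>{1..r}. ?Y i) \<and>
       (\<forall>i\<in>{1..r}. p i \<noteq> 0 \<longrightarrow> (q i \<noteq> 0 \<longrightarrow> ?XY i) \<and> (q i = 0 \<and> i < r \<and> p (i + 1) \<noteq> 0 \<longrightarrow> ?XX i)) \<and>
       (\<forall>i\<in>{1..<r}. q i \<noteq> 0 \<and> p (i + 1) \<noteq> 0 \<longrightarrow> ?YX i))"
    proof -
      have "i \<in> {1..<r} \<longleftrightarrow> i \<in> {1..r} \<and> i < r" for i
        by auto
      then show ?thesis
        using pS by blast
    qed
    finally show ?thesis .
  qed
  show ?thesis
    unfolding \<Delta>_def eq ..
qed

definition var_form :: "ivar \<Rightarrow> real \<Rightarrow> real" where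
  "var_form u t = (if starts_block u then 1 / (1 - t) else 1 / t)"

lemma prod_list_block_vars:
  assumes "v \<in> set blocks"
  shows "prod_list (map (\<lambda>u. var_form u (z u)) (block_vars v)) =
    1 / (1 - z (hd (block_vars v))) * prod_list (map (\<lambda>u. 1 / z u) (tl (block_vars v)))"
proof -
  obtain u us where u: "block_vars v = u # us"
    using block_vars_not_Nil[OF assms] by (cases "block_vars v") auto
  have "prod_list (map (\<lambda>u. var_form u (z u)) us) = prod_list (map (\<lambda>u. 1 / z u) us)"
    using not_starts_block_tl[OF assms] u
    by (intro arg_cong[where f = prod_list] map_cong) (auto simp: var_form_def)
  then show ?thesis
    using var_kernel_hd(1)[OF assms] u by (simp add: var_form_def)
qed

lemma integrand_eq: "integrand r p q \<alpha> \<beta> z = prod_list (map (\<lambda>u. var_form u (z u)) vars)"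
proof -
  let ?P = "\<lambda>v. prod_list (map (\<lambda>u. var_form u (z u)) (block_vars v))"
  have X: "?P (Xvar i k) = 1 / (1 - z (Xvar i (A i (k - 1) + 1))) *
      (\<Prod>j\<in>{A i (k - 1) + 2..A i k}. 1 / z (Xvar i j))"
    if "i \<in> {1..r}" "k \<in> {1..p i}" for i k
  proof -
    have mem: "Xvar i k \<in> set blocks"
      using that by (simp add: set_blocks)
    have "[Suc (A i (k - 1))..<Suc (A i k)] = Suc (A i (k - 1)) # [Suc (Suc (A i (k - 1)))..<Suc (A i k)]"
      using A_step_less[of i k] that by (intro upt_conv_Cons) auto
    then show ?thesis
      unfolding prod_list_block_vars[OF mem]
      by (simp add: comp_def prod_list_map_upt atLeastLessThanSuc_atLeastAtMost del: upt_Suc)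
  qed
  have Y: "?P (Yvar i l) = 1 / (1 - z (Yvar i (B i (l - 1) + 1))) *
      (\<Prod>j\<in>{B i (l - 1) + 2..B i l}. 1 / z (Yvar i j))"
    if "i \<in> {1..r}" "l \<in> {1..q i}" for i l
  proof -
    have mem: "Yvar i l \<in> set blocks"
      using that by (simp add: set_blocks)
    have "[Suc (B i (l - 1))..<Suc (B i l)] = Suc (B i (l - 1)) # [Suc (Suc (B i (l - 1)))..<Suc (B i l)]"
      using B_step_less[of i l] that by (intro upt_conv_Cons) auto
    then show ?thesis
      unfolding prod_list_block_vars[OF mem]
      by (simp add: comp_def prod_list_map_upt atLeastLessThanSuc_atLeastAtMost del: upt_Suc)
  qed
  have "prod_list (map (\<lambda>u. var_form u (z u)) vars) = prod_list (map ?P blocks)"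
    unfolding concat_block_vars[symmetric] by (simp add: map_concat prod_list_concat comp_def)
  also have "\<dots> = (\<Prod>i\<in>{1..r}. prod_list (map ?P (hook_blocks i)))"
    unfolding blocks_def
    by (simp add: map_concat prod_list_concat comp_def prod_list_map_upt atLeastLessThanSuc_atLeastAtMost del: upt_Suc)
  also have "\<dots> = (\<Prod>i\<in>{1..r}. (\<Prod>k\<in>{1..p i}. ?P (Xvar i k)) * (\<Prod>l\<in>{1..q i}. ?P (Yvar i l)))"
    unfolding hook_blocks_def map_append prod_list.append map_map comp_def prod_list_map_upt
      atLeastLessThanSuc_atLeastAtMost ..
  also have "\<dots> = integrand r p q \<alpha> \<beta> z"
    unfolding integrand_def by (intro prod.cong refl arg_cong2[of _ _ _ _ "(*)"] X Y)
  finally show ?thesis ..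
qed

abbreviation \<Delta>_integrand :: "(ivar \<Rightarrow> real) \<Rightarrow> real" where
  "\<Delta>_integrand z \<equiv> indicator (\<Delta> r p q \<alpha> \<beta>) z * integrand r p q \<alpha> \<beta> z"

text \<open>Outside the cube both sides are 0, on the right because of the indicators in the forms. On the
cube, also on its boundary, the values agree because both sides use \<open>1 / 0 = 0\<close>.\<close>

lemma indicator_integrand_eq_chain_weight:
  assumes vars: "vars = u # V" and z: "z \<in> extensional (ivars r p q \<alpha> \<beta>)"
  shows "ennreal (indicator (\<Delta> r p q \<alpha> \<beta>) z * integrand r p q \<alpha> \<beta> z) =
    form1 (z u) * chain_weight var_kernel u V z"
proof -
  let ?f = "\<lambda>w t. (if starts_block w then form1 else form0) t"
  have blocks: "blocks \<noteq> []"
    using concat_block_vars vars by auto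
  then obtain v L where L: "blocks = v # L"
    by (cases blocks) auto
  have v: "v \<in> set blocks"
    by (simp add: L)
  have "u = hd (block_vars v)"
    using concat_block_vars block_vars_not_Nil[OF v] unfolding L vars by (cases "block_vars v") auto
  then have u: "starts_block u"
    using var_kernel_hd(1)[OF v] by simp
  have "chain_weight var_kernel u V z =
    of_bool (successively (var_order z) (u # V)) * prod_list (map (\<lambda>w. ?f w (z w)) V)"
    unfolding var_order_def
    by (rule chain_weight_eq) (simp add: var_kernel_def step_kernel_def)
  then have "form1 (z u) * chain_weight var_kernel u V z =
    of_bool (successively (var_order z) vars) * prod_list (map (\<lambda>w. ?f w (z w)) vars)"
    using u vars by (simp add: mult_ac)
  also have "\<dots> = ennreal (indicator (\<Delta> r p q \<alpha> \<beta>) z * integrand r p q \<alpha> \<beta> z)"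
  proof (cases "\<forall>w\<in>set vars. z w \<in> {0..1}")
    case True
    have nonneg: "0 \<le> var_form w (z w)" if "w \<in> set vars" for w
      using True that by (auto simp: var_form_def)
    have "prod_list (map (\<lambda>w. ?f w (z w)) vars) = prod_list (map (\<lambda>w. ennreal (var_form w (z w))) vars)"
      using True
      by (intro arg_cong[where f = prod_list] map_cong) (auto simp: var_form_def form0_def form1_def)
    also have "\<dots> = ennreal (integrand r p q \<alpha> \<beta> z)"
      unfolding integrand_eq using nonneg by (rule prod_list_ennreal)
    finally have "prod_list (map (\<lambda>w. ?f w (z w)) vars) = ennreal (integrand r p q \<alpha> \<beta> z)" .
    moreover have "z \<in> \<Delta> r p q \<alpha> \<beta> \<longleftrightarrow> successively (var_order z) vars"
      using True z by (auto simp: \<Delta>_eq set_vars PiE_def)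
    ultimately show ?thesis
      by (auto simp: indicator_def)
  next
    case False
    then obtain w where w: "w \<in> set vars" "z w \<notin> {0..1}"
      by auto
    then have "?f w (z w) = 0"
      by (auto simp: form0_def form1_def)
    then have "prod_list (map (\<lambda>w. ?f w (z w)) vars) = 0"
      using w(1) by (auto simp: prod_list_zero_iff image_iff intro: bexI[of _ w])
    moreover have "z \<notin> \<Delta> r p q \<alpha> \<beta>"
      using w by (auto simp: \<Delta>_eq set_vars PiE_def)
    ultimately show ?thesis
      by simp
  qed
  finally show ?thesis ..
qed

lemma \<Delta>_integrand_nonneg: "0 \<le> indicator (\<Delta> r p q \<alpha> \<beta>) z * integrand r p q \<alpha> \<beta> z"
proof (cases "z \<in> \<Delta> r p q \<alpha> \<beta>")
  case True
  then have "z u \<in> {0..1}" if "u \<in> set vars" for u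
    using that unfolding \<Delta>_eq set_vars by blast
  then show ?thesis
    unfolding integrand_eq using True by (auto simp: var_form_def intro!: prod_list_nonneg)
qed simp

section \<open>The boxes as a lattice path\<close>

definition row_offset :: "nat \<Rightarrow> nat" where
  "row_offset i = (\<Sum>j\<in>{1..<i}. arm_height (p j) + q j)"

definition col_offset :: "nat \<Rightarrow> nat" where
  "col_offset i = (\<Sum>j\<in>{i<..r}. p j - 1)"

lemma rib_position_eq: "rib_position r p q i (a, b) = (a + row_offset i, b + col_offset i)"
  by (simp add: rib_position_def row_offset_def col_offset_def)

text \<open>Three facts about each step of the path are proved together: it goes left or down, the names tell
which, and a step to the left starts from a box with the better growth rate.\<close>

definition block_step :: "ivar \<Rightarrow> ivar \<Rightarrow> bool" where
  "block_step v w \<longleftrightarrow> ribbon_step (block_box v) (block_box w) \<and>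
    (fst (block_box w) = fst (block_box v) \<longleftrightarrow> goes_left w) \<and>
    (goes_left w \<longrightarrow> goes_left v \<or> 2 \<le> block_exponent v)"

lemma block_step_hook:
  assumes i: "i \<in> {1..r}"
  shows "successively block_step (hook_blocks i)"
proof -
  have "block_step (Xvar i k) (Xvar i (Suc k))" if "1 \<le> k" "Suc k < Suc (p i)" for k
  proof (cases "k = 1")
    case True
    then show ?thesis
      using that \<alpha>_last[OF i] by (auto simp: block_step_def ribbon_step_def rib_position_eq Suc_diff_Suc)
  next
    case False
    then show ?thesis
      using that by (auto simp: block_step_def ribbon_step_def rib_position_eq Suc_diff_Suc)
  qed
  moreover have "block_step (Yvar i l) (Yvar i (Suc l))" for l
    by (auto simp: block_step_def ribbon_step_def rib_position_eq)
  moreover have "block_step (Xvar i (p i)) (Yvar i 1)" if "p i \<noteq> 0"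
    using that by (auto simp: block_step_def ribbon_step_def rib_position_eq arm_height_def)
  moreover have "last (map (Xvar i) [1..<Suc (p i)]) = Xvar i (p i)" if "p i \<noteq> 0"
    using that by simp
  moreover have "hd (map (Yvar i) [1..<Suc (q i)]) = Yvar i 1" if "q i \<noteq> 0"
    using that by (simp add: upt_conv_Cons del: upt_Suc)
  moreover have "map (Xvar i) [1..<Suc (p i)] = [] \<longleftrightarrow> p i = 0" "map (Yvar i) [1..<Suc (q i)] = [] \<longleftrightarrow> q i = 0"
    by (auto simp del: upt_Suc)
  ultimately show ?thesis
    unfolding hook_blocks_def successively_append_iff successively_map_upt by metis
qed

lemma hook_blocks_eq_Nil_iff: "hook_blocks i = [] \<longleftrightarrow> p i = 0 \<and> q i = 0"
  by (simp add: hook_blocks_def del: upt_Suc)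

lemma last_hook_blocks: "hook_blocks i \<noteq> [] \<Longrightarrow>
    last (hook_blocks i) = (if q i = 0 then Xvar i (p i) else Yvar i (q i))"
  by (auto simp: hook_blocks_eq_Nil_iff) (auto simp: hook_blocks_def)

lemma block_step_next_hook:
  assumes i: "i \<in> {1..<r}" "hook_blocks i \<noteq> []"
  shows "block_step (last (hook_blocks i)) (Xvar (Suc i) 1)"
proof -
  have p: "1 \<le> p (Suc i)"
    using arm_pos[of "Suc i"] i by auto
  have row: "row_offset (Suc i) = row_offset i + (arm_height (p i) + q i)"
    using i by (simp add: row_offset_def)
  have "{i<..r} = insert (Suc i) {Suc i<..r}"
    using i by auto
  then have col: "col_offset i = (p (Suc i) - 1) + col_offset (Suc i)"
    by (simp add: col_offset_def)
  show ?thesis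
    unfolding last_hook_blocks[OF i(2)]
    using p i(2)[unfolded hook_blocks_eq_Nil_iff]
    by (auto simp: block_step_def ribbon_step_def rib_position_eq row col arm_height_def)
qed

lemma hd_hook_blocks: "1 \<le> p i \<Longrightarrow> hd (hook_blocks i) = Xvar i 1"
  by (simp add: hook_blocks_def upt_conv_Cons del: upt_Suc)

lemma block_step_blocks: "successively block_step blocks"
  unfolding blocks_def
proof (subst successively_concat_upt)
  show "hook_blocks i \<noteq> []" if "2 \<le> i" "i \<le> r" for i
    using arm_pos[OF that] by (simp add: hook_blocks_eq_Nil_iff)
  show "(\<forall>i\<in>{1..r}. successively block_step (hook_blocks i)) \<and>
    (\<forall>i\<in>{1..<r}. hook_blocks i \<noteq> [] \<longrightarrow> block_step (last (hook_blocks i)) (hd (hook_blocks (Suc i))))"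
    using block_step_hook block_step_next_hook hd_hook_blocks arm_pos by fastforce
qed

lemma block_box_blocks: "block_box ` set blocks = rib r p q"
proof -
  have "block_box ` set (hook_blocks i) = rib_position r p q i ` hook (p i) (q i)" for i
  proof -
    have "(\<lambda>k. p i + 1 - k) ` {1..p i} = {1..p i}"
    proof
      show "{1..p i} \<subseteq> (\<lambda>k. p i + 1 - k) ` {1..p i}"
      proof
        fix j assume "j \<in> {1..p i}"
        then show "j \<in> (\<lambda>k. p i + 1 - k) ` {1..p i}"
          by (intro image_eqI[of _ _ "p i + 1 - j"]) auto
      qed
    qed auto
    then have "(\<lambda>k. rib_position r p q i (1, p i + 1 - k)) ` {1..p i} =
        (\<lambda>j. rib_position r p q i (1, j)) ` {1..p i}"
      by (metis (no_types, lifting) image_cong image_image)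
    then show ?thesis
      unfolding hook_blocks_def hook_def Setcompr_eq_image
      by (simp add: image_Un image_image atLeastLessThanSuc_atLeastAtMost del: upt_Suc)
  qed
  then show ?thesis
    unfolding rib_def blocks_def
    by (simp add: image_UN atLeastLessThanSuc_atLeastAtMost del: upt_Suc)
qed

lemma ribbon_step_blocks: "successively ribbon_step (map block_box blocks)"
  unfolding successively_map by (rule successively_mono[OF block_step_blocks]) (auto simp: block_step_def)

lemma inj_on_block_box: "inj_on block_box (set blocks)"
  using ribbon_path_distinct[OF ribbon_step_blocks] by (simp add: distinct_map)

lemma last_blocks:
  assumes "blocks \<noteq> []"
  shows "goes_left (last blocks) \<or> 2 \<le> block_exponent (last blocks)"
proof -
  have ne: "hook_blocks r \<noteq> []"
  proof (cases "r = 1")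
    case True
    then have "blocks = hook_blocks r"
      unfolding blocks_def by simp
    then show ?thesis
      using assms by simp
  next
    case False
    then show ?thesis
      using arm_pos[of r] r_pos by (simp add: hook_blocks_eq_Nil_iff)
  qed
  then have "last blocks = last (hook_blocks r)"
    using r_pos by (simp add: blocks_def)
  then show ?thesis
    using last_hook_blocks[OF ne] ne[unfolded hook_blocks_eq_Nil_iff] \<beta>_last \<alpha>_last[of r] r_pos
    by (cases "p r = 1") auto
qed

lemma hd_blocks: "blocks = v # L \<Longrightarrow> \<not> goes_left v"
proof -
  assume L: "blocks = v # L"
  have "\<not> goes_left (hd (hook_blocks i))" if "hook_blocks i \<noteq> []" for i
    using that by (cases "p i = 0") (auto simp: hook_blocks_def upt_conv_Cons simp del: upt_Suc)
  then have "\<not> goes_left (hd (concat (map hook_blocks is)))" if "concat (map hook_blocks is) \<noteq> []" for "is"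
    using that by (induction "is") (auto simp: hd_append)
  then show ?thesis
    using L unfolding blocks_def by (metis list.sel(1) list.discI)
qed


lemma \<gamma>_block_box:
  assumes "connects_fillings r p q (\<lambda>i. hook_filling (p i) (\<alpha> i) (\<beta> i)) \<gamma>" "v \<in> set blocks"
  shows "\<gamma> (block_box v) = block_exponent v"
proof -
  consider i k where "v = Xvar i k" "i \<in> {1..r}" "k \<in> {1..p i}"
    | i l where "v = Yvar i l" "i \<in> {1..r}" "l \<in> {1..q i}"
    using assms(2) by (auto simp: set_blocks)
  then show ?thesis
  proof cases
    case 1
    have "(1, p i + 1 - k) \<in> hook (p i) (q i)"
      unfolding hook_def using 1 by (intro UnI1 CollectI exI[of _ "p i + 1 - k"]) auto
    then have "\<gamma> (block_box v) = hook_filling (p i) (\<alpha> i) (\<beta> i) (1, p i + 1 - k)"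
      using assms(1) 1 unfolding connects_fillings_def by simp
    also have "\<dots> = \<alpha> i (p i + 1 - k)"
      using 1 by (auto simp: hook_filling_def arm_height_def)
    finally show ?thesis
      using 1 by simp
  next
    case 2
    have "(arm_height (p i) + l, 1) \<in> hook (p i) (q i)"
      unfolding hook_def using 2 by blast
    then have "\<gamma> (block_box v) = hook_filling (p i) (\<alpha> i) (\<beta> i) (arm_height (p i) + l, 1)"
      using assms(1) 2 unfolding connects_fillings_def by simp
    also have "\<dots> = \<beta> i l"
      using 2 by (auto simp: hook_filling_def)
    finally show ?thesis
      using 2 by simp
  qed
qed

text \<open>A corner is followed by a step to the left or is the last box, and it is not reached by a step to
the left itself.\<close>

lemma corner_exponent:
  assumes "v \<in> set blocks" "block_box v \<in> corners (rib r p q)"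
  shows "2 \<le> block_exponent v"
proof -
  obtain n where n: "n < length blocks" "blocks ! n = v"
    using assms(1) by (auto simp: in_set_conv_nth)
  have not_rib: "(Suc (fst (block_box v)), snd (block_box v)) \<notin> rib r p q"
    "(fst (block_box v), Suc (snd (block_box v))) \<notin> rib r p q"
    using assms(2) by (auto simp: corners_def)
  have mem: "block_box (blocks ! m) \<in> rib r p q" if "m < length blocks" for m
    using that block_box_blocks by (metis image_eqI nth_mem)
  have next_left: "goes_left (blocks ! Suc n)" if "Suc n < length blocks"
  proof -
    have "block_step v (blocks ! Suc n)"
      using successively_nth[OF block_step_blocks that] n by simp
    then show ?thesis
      using mem[OF that] not_rib(1) unfolding block_step_def ribbon_step_def by (metis prod.collapse)
  qed
  have not_left: "\<not> goes_left v"
  proof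
    assume left: "goes_left v"
    show False
    proof (cases n)
      case 0
      then show False
        using hd_blocks[of v "tl blocks"] left n by (cases blocks) auto
    next
      case (Suc m)
      then have "block_step (blocks ! m) v"
        using successively_nth[OF block_step_blocks, of m] n by simp
      then have "block_box (blocks ! m) = (fst (block_box v), Suc (snd (block_box v)))"
        using left by (auto simp: block_step_def ribbon_step_def intro: prod_eqI)
      then show False
        using mem[of m] not_rib(2) n Suc by simp
    qed
  qed
  show ?thesis
  proof (cases "Suc n < length blocks")
    case True
    then have "block_step v (blocks ! Suc n)"
      using successively_nth[OF block_step_blocks True] n by simp
    then show ?thesis
      using next_left[OF True] not_left by (auto simp: block_step_def)
  next
    case False
    then have "v = last blocks"
      using n by (metis Suc_lessI diff_Suc_1 last_conv_nth length_0_conv less_nat_zero_code)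
    then show ?thesis
      using last_blocks not_left n by fastforce
  qed
qed

lemma \<gamma>_admissible:
  assumes "connects_fillings r p q (\<lambda>i. hook_filling (p i) (\<alpha> i) (\<beta> i)) \<gamma>"
  shows "\<gamma> \<in> admissible_fillings (rib r p q)"
proof -
  have "1 \<le> \<gamma> b" if "b \<in> rib r p q" for b
    using that \<gamma>_block_box[OF assms] block_exponent_pos unfolding block_box_blocks[symmetric] by auto
  moreover have "2 \<le> \<gamma> b" if "b \<in> corners (rib r p q)" for b
  proof -
    have "b \<in> rib r p q"
      using that by (auto simp: corners_def)
    then obtain v where "v \<in> set blocks" "b = block_box v"
      unfolding block_box_blocks[symmetric] by auto
    then show ?thesis
      using corner_exponent[of v] \<gamma>_block_box[OF assms, of v] that by simp
  qed
  ultimately show ?thesis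
    by (simp add: admissible_fillings_def)
qed

section \<open>The sum and the integral of a ribbon\<close>

text \<open>The values of \<open>left\<close> are given on boxes and not on their names, since the fillings are functions
on boxes.\<close>

lemma \<zeta>_term_eq_chain_weight:
  fixes left :: "box \<Rightarrow> bool"
  assumes path: "map block_box blocks = b # L"
    and left: "\<And>v. v \<in> set blocks \<Longrightarrow> left (block_box v) = goes_left v"
    and m: "m \<in> rib r p q \<rightarrow>\<^sub>E {1..}"
  shows "ennreal (indicator (semistandard_fillings (rib r p q)) m * schur_zeta_term (rib r p q) \<gamma> m) =
    ennreal (1 / real (m b)) ^ \<gamma> b * chain_weight (\<lambda>w. box_kernel (left w) (\<gamma> w)) b L m"
proof -
  have set: "set (b # L) = rib r p q"
    using block_box_blocks path by (metis list.set_map)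
  have ribbon: "successively ribbon_step (b # L)"
    using ribbon_step_blocks unfolding path .
  then have dist: "distinct (b # L)"
    by (rule ribbon_path_distinct)
  let ?R = "\<lambda>u w. if left w then m w \<le> m u else m u < m w"
  have "successively (\<lambda>u w. fst w = fst u \<longleftrightarrow> left w) (map block_box blocks)"
    unfolding successively_map
    by (rule successively_mono[OF block_step_blocks]) (simp add: block_step_def left)
  then have "successively (\<lambda>u w. ?R u w = box_order m u w) (b # L)"
    unfolding path by (rule successively_mono) (simp add: box_order_def)
  then have R: "successively ?R (b # L) = successively (box_order m) (b # L)"
    by (rule successively_cong_pairs)
  have "chain_weight (\<lambda>w. box_kernel (left w) (\<gamma> w)) b L m =
    of_bool (successively ?R (b # L)) * prod_list (map (\<lambda>w. ennreal (1 / real (m w)) ^ \<gamma> w) L)"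
    by (rule chain_weight_eq) (simp add: box_kernel_def)
  then have "ennreal (1 / real (m b)) ^ \<gamma> b * chain_weight (\<lambda>w. box_kernel (left w) (\<gamma> w)) b L m =
    of_bool (successively ?R (b # L)) * prod_list (map (\<lambda>w. ennreal (1 / real (m w)) ^ \<gamma> w) (b # L))"
    by (simp add: mult_ac)
  also have "prod_list (map (\<lambda>w. ennreal (1 / real (m w)) ^ \<gamma> w) (b # L)) =
    prod_list (map (\<lambda>w. ennreal (1 / real (m w) ^ \<gamma> w)) (b # L))"
    by (simp add: ennreal_power power_divide)
  also have "\<dots> = ennreal (prod_list (map (\<lambda>w. 1 / real (m w) ^ \<gamma> w) (b # L)))"
    by (rule prod_list_ennreal) simp
  also have "prod_list (map (\<lambda>w. 1 / real (m w) ^ \<gamma> w) (b # L)) = schur_zeta_term (rib r p q) \<gamma> m"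
    unfolding schur_zeta_term_def set[symmetric]
    by (rule prod.distinct_set_conv_list[OF dist, symmetric])
  also have "of_bool (successively ?R (b # L)) * ennreal (schur_zeta_term (rib r p q) \<gamma> m) =
    ennreal (indicator (semistandard_fillings (rib r p q)) m * schur_zeta_term (rib r p q) \<gamma> m)"
    using m semistandard_ribbon_path[OF ribbon] R unfolding set by (auto simp: indicator_def)
  finally show ?thesis ..
qed

lemma measurable_var_kernel: "case_prod (var_kernel u) \<in> borel_measurable (lborel \<Otimes>\<^sub>M lborel)"
proof -
  have "case_prod (var_kernel u) \<in> borel_measurable (borel \<Otimes>\<^sub>M borel)"
    unfolding var_kernel_def by (intro measurable_step_kernel) auto
  then show ?thesis
    by (simp cong: measurable_cong_sets sets_pair_measure_cong)
qed

text \<open>Both sides are chains over the boxes of the ribbon; as distinct names denote distinct boxes, the data of a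
box can be read off from its name.\<close>

lemma schur_zeta_chain:
  assumes \<gamma>: "connects_fillings r p q (\<lambda>i. hook_filling (p i) (\<alpha> i) (\<beta> i)) \<gamma>"
    and ne: "blocks \<noteq> []"
  shows "\<Delta>_integrand \<in> borel_measurable (ivars_measure r p q \<alpha> \<beta>)"
    and "(\<integral>\<^sup>+m. ennreal (schur_zeta_term (rib r p q) \<gamma> m)
      \<partial>count_space (semistandard_fillings (rib r p q))) < \<infinity>"
    and "(\<integral>\<^sup>+z. ennreal (\<Delta>_integrand z) \<partial>ivars_measure r p q \<alpha> \<beta>) = (\<integral>\<^sup>+m. ennreal (schur_zeta_term (rib r p q) \<gamma> m)
      \<partial>count_space (semistandard_fillings (rib r p q)))"
proof -
  let ?M = "ivars_measure r p q \<alpha> \<beta>"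
  let ?S = "semistandard_fillings (rib r p q)"
  let ?T = "schur_zeta_term (rib r p q) \<gamma>"
  obtain b L where path: "map block_box blocks = b # L"
    using ne by (cases blocks) auto
  define block_of where "block_of = inv_into (set blocks) block_box"
  have block_of: "block_of (block_box v) = v" if "v \<in> set blocks" for v
    unfolding block_of_def using inj_on_block_box that by (rule inv_into_f_f)
  define left where "left = (\<lambda>c. goes_left (block_of c))"
  define cvars where "cvars = (\<lambda>c. block_vars (block_of c))"
  have set: "set (b # L) = rib r p q"
    using block_box_blocks path by (metis list.set_map)
  have block: "\<exists>v\<in>set blocks. c = block_box v" if "c \<in> set (b # L)" for c
    using that unfolding set block_box_blocks[symmetric] by auto
  have concat_cvars: "concat (map cvars (b # L)) = vars"
    unfolding path[symmetric] concat_block_vars[symmetric] map_map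
    by (intro arg_cong[where f = concat] map_cong) (auto simp: cvars_def block_of)
  obtain v0 L0 where v0: "blocks = v0 # L0"
    using ne by (cases blocks) auto
  have b: "b = block_box v0"
    using path v0 by simp
  have "vars \<noteq> []"
    using block_vars_not_Nil[of v0] unfolding concat_block_vars[symmetric] v0 by simp
  then obtain u V where V: "vars = u # V"
    by (cases vars) auto
  have dist: "distinct (b # L)"
    using ribbon_path_distinct[OF ribbon_step_blocks] unfolding path .
  let ?sum = "\<integral>\<^sup>+m. ennreal (1 / real (m b)) ^ \<gamma> b *
      chain_weight (\<lambda>w. box_kernel (left w) (\<gamma> w)) b L m \<partial>Pi\<^sub>M (set (b # L)) (\<lambda>_. pos_count)"
  have "(\<integral>\<^sup>+m. ennreal (?T m) \<partial>count_space ?S) =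
    (\<integral>\<^sup>+m. ennreal (indicator ?S m * ?T m) \<partial>count_space ?S)"
    by (intro nn_integral_cong) auto
  also have "\<dots> = (\<integral>\<^sup>+m. ennreal (indicator ?S m * ?T m) \<partial>count_space (rib r p q \<rightarrow>\<^sub>E {1..}))"
    by (rule nn_integral_count_space_eq) (auto simp: semistandard_fillings_def)
  also have "\<dots> = (\<integral>\<^sup>+m. ennreal (1 / real (m b)) ^ \<gamma> b *
      chain_weight (\<lambda>w. box_kernel (left w) (\<gamma> w)) b L m \<partial>count_space (rib r p q \<rightarrow>\<^sub>E {1..}))"
    by (intro nn_integral_cong \<zeta>_term_eq_chain_weight[OF path])
       (auto simp: left_def block_of simp del: One_nat_def)
  also have "count_space (rib r p q \<rightarrow>\<^sub>E {1..}) = Pi\<^sub>M (set (b # L)) (\<lambda>_. pos_count)"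
    unfolding set[symmetric] by (rule count_space_PiM_finite[symmetric]) auto
  finally have zeta: "(\<integral>\<^sup>+m. ennreal (?T m) \<partial>count_space ?S) = ?sum" .
  have "?sum < \<infinity>"
  proof (rule chain_sum_finite[OF dist])
    show "1 \<le> \<gamma> c" if "c \<in> set (b # L)" for c
      using block[OF that] \<gamma>_block_box[OF \<gamma>] block_exponent_pos by auto
    show "\<not> left b"
      unfolding b left_def using hd_blocks[OF v0] block_of[of v0] v0 by simp
    have "successively (\<lambda>v w. left (block_box w) \<longrightarrow> left (block_box v) \<or> 2 \<le> \<gamma> (block_box v)) blocks"
      by (rule successively_mono[OF block_step_blocks])
         (simp add: block_step_def left_def block_of \<gamma>_block_box[OF \<gamma>])
    then show "successively (\<lambda>u v. left v \<longrightarrow> left u \<or> 2 \<le> \<gamma> u) (b # L)"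
      unfolding path[symmetric] successively_map .
    have "last (b # L) = block_box (last blocks)"
      unfolding path[symmetric] using ne by (rule last_map)
    then show "left (last (b # L)) \<or> 2 \<le> \<gamma> (last (b # L))"
      using last_blocks[OF ne] ne by (simp add: left_def block_of \<gamma>_block_box[OF \<gamma>])
  qed
  then show "(\<integral>\<^sup>+m. ennreal (?T m) \<partial>count_space ?S) < \<infinity>"
    unfolding zeta .
  have I: "ennreal (\<Delta>_integrand z) = form1 (z u) * chain_weight var_kernel u V z" if "z \<in> space ?M" for z
    using that by (intro indicator_integrand_eq_chain_weight V) (auto simp: space_PiM PiE_def)
  have [measurable]: "u \<in> ivars r p q \<alpha> \<beta>"
    using V set_vars by auto
  have [measurable]: "chain_weight var_kernel u V \<in> borel_measurable ?M"
    by (rule measurable_chain_weight) (use measurable_var_kernel V set_vars in auto)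
  have nonneg: "0 \<le> \<Delta>_integrand z" for z
    using \<Delta>_integrand_nonneg .
  have "(\<lambda>z. enn2real (form1 (z u) * chain_weight var_kernel u V z)) \<in> borel_measurable ?M"
    by measurable
  then show "\<Delta>_integrand \<in> borel_measurable ?M"
    by (rule measurable_cong[THEN iffD1, rotated]) (use nonneg in \<open>simp add: I[symmetric]\<close>)
  have "(\<integral>\<^sup>+z. ennreal (\<Delta>_integrand z) \<partial>?M) = (\<integral>\<^sup>+z. form1 (z u) * chain_weight var_kernel u V z \<partial>?M)"
    by (intro nn_integral_cong I)
  also have "\<dots> = (\<integral>\<^sup>+z. form1 (z u) * chain_weight var_kernel u V z \<partial>Pi\<^sub>M (set (u # V)) (\<lambda>_. lborel))"
    unfolding V[symmetric] set_vars ..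
  also have "\<dots> = ?sum"
  proof (rule chain_integral_eq_chain_sum[where vars = cvars])
    show "cvars c \<noteq> [] \<and> length (cvars c) = \<gamma> c" if "c \<in> set (b # L)" for c
      using block[OF that] block_vars_not_Nil length_block_vars \<gamma>_block_box[OF \<gamma>]
      by (auto simp: cvars_def block_of)
    show "var_kernel (hd (cvars c)) = step_kernel (left c) form1" if c: "c \<in> set L" for c
    proof -
      obtain v where "v \<in> set blocks" "c = block_box v"
        using block[of c] c by auto
      then show ?thesis
        using var_kernel_hd by (simp add: var_kernel_def cvars_def left_def block_of)
    qed
    show "var_kernel w = step_kernel False form0" if c: "c \<in> set (b # L)" and w: "w \<in> set (tl (cvars c))" for c w
    proof -
      obtain v where "v \<in> set blocks" "c = block_box v"
        using block[OF c] by auto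
      then have "\<not> starts_block w"
        using not_starts_block_tl w by (simp add: cvars_def block_of)
      then show ?thesis
        using goes_up_imp_starts_block[of w] by (cases "goes_up w") (auto simp: var_kernel_def)
    qed
    show "distinct (b # L)"
      by (rule dist)
    show "distinct (concat (map cvars (b # L)))"
      unfolding concat_cvars by (rule distinct_vars)
    show "concat (map cvars (b # L)) = u # V"
      unfolding concat_cvars by (rule V)
  qed
  also have "?sum = (\<integral>\<^sup>+m. ennreal (?T m) \<partial>count_space ?S)"
    by (rule zeta[symmetric])
  finally show "(\<integral>\<^sup>+z. ennreal (\<Delta>_integrand z) \<partial>?M) = (\<integral>\<^sup>+m. ennreal (?T m) \<partial>count_space ?S)" .
qed

lemma schur_zeta_no_blocks:
  assumes "blocks = []"
  shows "\<Delta>_integrand \<in> borel_measurable (ivars_measure r p q \<alpha> \<beta>)"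
    and "(\<integral>\<^sup>+m. ennreal (schur_zeta_term (rib r p q) \<gamma> m)
      \<partial>count_space (semistandard_fillings (rib r p q))) < \<infinity>"
    and "(\<integral>\<^sup>+z. ennreal (\<Delta>_integrand z) \<partial>ivars_measure r p q \<alpha> \<beta>) = (\<integral>\<^sup>+m. ennreal (schur_zeta_term (rib r p q) \<gamma> m)
      \<partial>count_space (semistandard_fillings (rib r p q)))"
proof -
  let ?M = "ivars_measure r p q \<alpha> \<beta>"
  have vars: "vars = []"
    using concat_block_vars assms by simp
  have ivars: "ivars r p q \<alpha> \<beta> = {}" and rib: "rib r p q = {}"
    using set_vars vars block_box_blocks assms by auto
  have M: "?M = count_space {\<lambda>_. undefined}"
    unfolding ivars by (rule PiM_empty)
  have \<Delta>: "\<Delta> r p q \<alpha> \<beta> = {\<lambda>_. undefined}"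
    by (simp add: \<Delta>_eq ivars vars)
  have I: "integrand r p q \<alpha> \<beta> z = 1" for z
    by (simp add: integrand_eq vars)
  have S: "semistandard_fillings (rib r p q) = {\<lambda>_. undefined}"
    by (simp add: semistandard_fillings_def rib)
  have T: "schur_zeta_term (rib r p q) \<gamma> m = 1" for m
    by (simp add: schur_zeta_term_def rib)
  show "\<Delta>_integrand \<in> borel_measurable ?M"
    unfolding M by simp
  show "(\<integral>\<^sup>+m. ennreal (schur_zeta_term (rib r p q) \<gamma> m)
      \<partial>count_space (semistandard_fillings (rib r p q))) < \<infinity>"
    unfolding S T by (simp add: nn_integral_count_space_finite)
  show "(\<integral>\<^sup>+z. ennreal (\<Delta>_integrand z) \<partial>?M) = (\<integral>\<^sup>+m. ennreal (schur_zeta_term (rib r p q) \<gamma> m)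
      \<partial>count_space (semistandard_fillings (rib r p q)))"
    unfolding S T M \<Delta> I by (simp add: nn_integral_count_space_finite)
qed

end

theorem theorem6p2:
  fixes r :: nat and p q :: "nat \<Rightarrow> nat" and \<alpha> \<beta> :: "nat \<Rightarrow> nat \<Rightarrow> nat"
    and \<gamma> :: "nat \<times> nat \<Rightarrow> nat"
  assumes "1 \<le> r"
    and "minimal_expression r p q"
    and "\<And>i k. i \<in> {1..r} \<Longrightarrow> k \<in> {1..p i} \<Longrightarrow> 1 \<le> \<alpha> i k"
    and "\<And>i. i \<in> {1..r} \<Longrightarrow> 1 \<le> p i \<Longrightarrow> 2 \<le> \<alpha> i (p i)"
    and "\<And>i l. i \<in> {1..r} \<Longrightarrow> l \<in> {1..q i} \<Longrightarrow> 1 \<le> \<beta> i l"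
    and "1 \<le> q r \<Longrightarrow> 2 \<le> \<beta> r (q r)"
    and "connects_fillings r p q (\<lambda>i. hook_filling (p i) (\<alpha> i) (\<beta> i)) \<gamma>"
  shows "\<gamma> \<in> admissible_fillings (rib r p q)
    \<and> schur_zeta_term (rib r p q) \<gamma> summable_on semistandard_fillings (rib r p q)
    \<and> set_integrable (ivars_measure r p q \<alpha> \<beta>) (\<Delta> r p q \<alpha> \<beta>) (integrand r p q \<alpha> \<beta>)
    \<and> schur_zeta (rib r p q) \<gamma> =
        (LINT z:\<Delta> r p q \<alpha> \<beta>|ivars_measure r p q \<alpha> \<beta>. integrand r p q \<alpha> \<beta> z)"
proof -
  interpret ribbon_integral r p q \<alpha> \<beta>
    by standard (use assms minimal_expression_arm_pos in auto)
  let ?S = "semistandard_fillings (rib r p q)"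
  let ?T = "schur_zeta_term (rib r p q) \<gamma>"
  let ?I = "\<lambda>z. indicator (\<Delta> r p q \<alpha> \<beta>) z * integrand r p q \<alpha> \<beta> z"
  let ?M = "ivars_measure r p q \<alpha> \<beta>"
  have chain: "?I \<in> borel_measurable ?M \<and> (\<integral>\<^sup>+m. ennreal (?T m) \<partial>count_space ?S) < \<infinity> \<and>
    (\<integral>\<^sup>+z. ennreal (?I z) \<partial>?M) = (\<integral>\<^sup>+m. ennreal (?T m) \<partial>count_space ?S)"
  \<comment> \<open>For the empty ribbon both sides are 1, from the empty filling and from the one-point space.\<close>
  proof (cases "blocks = []")
    case True
    show ?thesis
      by (intro conjI schur_zeta_no_blocks[OF True])
  next
    case False
    show ?thesis
      by (intro conjI schur_zeta_chain[OF assms(7) False])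
  qed
  note meas = chain[THEN conjunct1] and finite = chain[THEN conjunct2, THEN conjunct1]
    and eq = chain[THEN conjunct2, THEN conjunct2]
  have T_nonneg: "0 \<le> ?T m" for m
    by (auto simp: schur_zeta_term_def intro!: prod_nonneg)
  have "integrable (count_space ?S) ?T"
    using T_nonneg finite by (intro integrableI_nonneg) auto
  then have T_summable: "Infinite_Set_Sum.abs_summable_on ?T ?S"
    by (simp add: abs_summable_on_def)
  then have summable: "?T summable_on ?S"
    unfolding summable_on_iff_abs_summable_on_real[of ?T] abs_summable_equivalent .
  have integrable: "integrable ?M ?I"
    using meas \<Delta>_integrand_nonneg finite eq by (intro integrableI_nonneg) auto
  have "schur_zeta (rib r p q) \<gamma> = infsetsum ?T ?S"
    unfolding schur_zeta_def using T_summable by (rule infsetsum_infsum[symmetric])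
  also have "\<dots> = enn2real (\<integral>\<^sup>+m. ennreal (?T m) \<partial>count_space ?S)"
    unfolding infsetsum_def using T_nonneg by (intro integral_eq_nn_integral) auto
  also have "\<dots> = (\<integral>z. ?I z \<partial>?M)"
    unfolding eq[symmetric] using meas \<Delta>_integrand_nonneg by (intro integral_eq_nn_integral[symmetric]) auto
  finally show ?thesis
    using \<gamma>_admissible[OF assms(7)] summable integrable
    by (simp add: set_integrable_def set_lebesgue_integral_def)
qed

end
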